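(* For every tree $T_n$ on $n$ vertices we have $$|\mathrm{End}(P_n)|\leq|\mathrm{End}(T_n)|\leq|\mathrm{End}(S_n)|.$$
   Context: Graphs are finite, undirected, without loops and multiple edges. For a graph $G$, $\mathrm{End}(G)$ is the set of endomorphisms of $G$, i.e. maps $f:V(G)\to V(G)$ such that images of adjacent vertices are adjacent. $P_n$ and $S_n$ are the path and the star on $n$ vertices. *)

theory Defs
  imports "Graph_Theory.Graph_Theory" "HOL-Library.FuncSet"
begin

text \<open>
  A finite undirected graph without loops and multiple edges is a \<^locale>\<open>pair_graph\<close>:
  a finite vertex set with an irreflexive symmetric adjacency relation on it.
\<close>

text \<open>
  The library predicate \<^const>\<open>tree\<close> is not used: on a symmetric digraph it counts the
  closed walk \<open>a, b, a\<close> as a cycle, so it would hold of no undirected tree with an edge. A cycle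
  of the undirected graph is a \<^const>\<open>pre_digraph.cycle\<close> with at least three arcs.
  \<^const>\<open>connected\<close> excludes the graph without vertices.
\<close>

definition undirected_tree :: "'a pair_pre_digraph \<Rightarrow> bool" where
  "undirected_tree T \<longleftrightarrow> pair_graph T \<and> connected (with_proj T) \<and>
     \<not> (\<exists>p. pre_digraph.cycle (with_proj T) p \<and> 3 \<le> length p)"

text \<open>
  Maps from the vertex set to itself are extensional functions, so that each of them is counted
  exactly once.
\<close>

definition End :: "'a pair_pre_digraph \<Rightarrow> ('a \<Rightarrow> 'a) set" where
  "End G = {f \<in> pverts G \<rightarrow>\<^sub>E pverts G. \<forall>u v. (u, v) \<in> parcs G \<longrightarrow> (f u, f v) \<in> parcs G}"

definition path_graph :: "nat \<Rightarrow> nat pair_pre_digraph" where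
  "path_graph n = \<lparr> pverts = {..<n},
     parcs = {(i, j). i < n \<and> j < n \<and> (j = Suc i \<or> i = Suc j)} \<rparr>"

text \<open>The centre of the star is the vertex \<open>0\<close>.\<close>

definition star_graph :: "nat \<Rightarrow> nat pair_pre_digraph" where
  "star_graph n = \<lparr> pverts = {..<n},
     parcs = {(i, j). i < n \<and> j < n \<and> (i = 0 \<and> j \<noteq> 0 \<or> i \<noteq> 0 \<and> j = 0)} \<rparr>"

lemma pair_graph_path_graph: "pair_graph (path_graph n)"
proof -
  have "finite (parcs (path_graph n))"
    by (rule finite_subset[of _ "{..<n} \<times> {..<n}"]) (auto simp: path_graph_def)
  then show ?thesis
    by unfold_locales (auto simp: path_graph_def symmetric_def sym_def)
qed

lemma pair_graph_star_graph: "pair_graph (star_graph n)"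
proof -
  have "finite (parcs (star_graph n))"
    by (rule finite_subset[of _ "{..<n} \<times> {..<n}"]) (auto simp: star_graph_def)
  then show ?thesis
    by unfold_locales (auto simp: star_graph_def symmetric_def sym_def)
qed

lemma (in pair_graph) finite_End: "finite (End G)"
  by (rule finite_subset[of _ "pverts G \<rightarrow>\<^sub>E pverts G"])
     (auto simp: End_def intro!: finite_PiE pair_finite_verts)

end

theory Submission
  imports Defs "HOL-Analysis.Harmonic_Numbers"
begin

text \<open>
  Write \<open>hom(H, G)\<close> for the number of homomorphisms from \<open>H\<close> to \<open>G\<close>, so that \<open>|End(T)| = hom(T, T)\<close>. A tree is
  grown from any of its vertices by successively attaching leaves, and attaching a leaf \<open>u\<close> to \<open>p\<close>
  replaces each homomorphism \<open>f\<close> by its extensions \<open>f(u := y)\<close>, one for each neighbour \<open>y\<close> of \<open>f p\<close>. All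
  counts below are inductions along such a growth (\<open>sum_homs_leaf\<close>).

  Upper bound. The star maximises the number of homomorphisms of a tree on \<open>n\<close> vertices into any fixed
  graph: \<open>hom(T, G) \<le> \<Sum>\<^sub>x deg(x)^(n - 1)\<close> (\<open>card_homs_le_sum_deg\<close>), with equality when \<open>T\<close> is the star. For
  \<open>G\<close> a tree, the degrees lie between \<open>1\<close> and \<open>n - 1\<close> and have sum \<open>2 (n - 1)\<close>, so by convexity the power
  sum is at most its value \<open>(n - 1)^(n - 1) + (n - 1)\<close> at the star.

  Lower bound. The star bound applied to the path itself gives
  \<open>|End(P\<^sub>n)| \<le> (n - 2) 2^(n - 1) + 2\<close> (\<open>card_End_path_le\<close>). To reach this number, map \<open>T\<close> to \<open>G\<close> at random: the
  image of the first vertex has the stationary distribution of a Markov chain on \<open>G\<close>, and the image of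
  every new leaf is one step of the chain from the image of its neighbour. The entropy of this random
  homomorphism is the entropy of the stationary distribution plus \<open>n - 1\<close> times the entropy rate of the
  chain, and it is at most the logarithm of \<open>hom(T, G)\<close> (\<open>exp_entropy_le_card_homs\<close>). Take \<open>G = T\<close> and the
  random walk in which an edge at a leaf has weight \<open>q\<close> and any other edge has weight \<open>1\<close>.

  \<^item> With at least four leaves, \<open>q = 1/2\<close> gives an entropy rate of at least \<open>ln 2\<close>, and the bound is
    at least \<open>(n - 2) 2^(n - 1) + 2\<close> (\<open>many_leaves_card_homs\<close>).
  \<^item> With exactly three leaves, none of which is adjacent to the vertex of degree three, \<open>q = 1/3\<close> gives
    the rate \<open>ln 2\<close> exactly, and the bound again suffices (\<open>three_leaves_card_homs\<close>).
  \<^item> The remaining branching trees are the spiders with legs \<open>1\<close>, \<open>b\<close>, \<open>c\<close>. For them the entropy loses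
    too much, because of the ends of the long legs. Instead, \<open>hom(T, G) = \<Sum>\<^sub>x deg(x) w\<^sub>b(x) w\<^sub>c(x)\<close> where
    \<open>w\<^sub>k(x)\<close> is the number of walks of length \<open>k\<close> from \<open>x\<close>, and the walks on the spider are compared with
    those on the path vertex by vertex (\<open>card_End_path_le_spider\<close>).
  \<^item> A tree without a vertex of degree three or more is a path (\<open>max_deg_two_path\<close>).
\<close>

section \<open>Growing a tree leaf by leaf\<close>

inductive rooted_tree :: "'a \<Rightarrow> 'a set \<Rightarrow> ('a \<times> 'a) set \<Rightarrow> bool" for r where
  root: "rooted_tree r {r} {}"
| leaf: "rooted_tree r S E \<Longrightarrow> p \<in> S \<Longrightarrow> u \<notin> S \<Longrightarrow>
    rooted_tree r (insert u S) (insert (u, p) (insert (p, u) E))"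

lemma rooted_tree_basic:
  assumes "rooted_tree r S E"
  shows "finite S" "E \<subseteq> S \<times> S" "sym E" "r \<in> S" "\<And>x. (x, x) \<notin> E"
  using assms by (induction) (auto simp: sym_def)

text \<open>
  A vertex newly attached to the root may take over as the root: the old root then becomes the first leaf.
  With this step the growth can be started from any vertex.
\<close>
lemma rooted_tree_new_root:
  assumes "rooted_tree p S E" "u \<notin> S"
  shows "rooted_tree u (insert u S) (insert (u, p) (insert (p, u) E))"
  using assms
proof (induction)
  case root
  then have "rooted_tree u (insert p {u}) (insert (p, u) (insert (u, p) {}))"
    by (intro rooted_tree.leaf rooted_tree.root) auto
  then show ?case by (simp add: insert_commute)
next
  case (leaf S E p' v)
  then have "rooted_tree u (insert u S) (insert (u, p) (insert (p, u) E))" by simp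
  then have "rooted_tree u (insert v (insert u S))
     (insert (v, p') (insert (p', v) (insert (u, p) (insert (p, u) E))))"
    by (rule rooted_tree.leaf) (use leaf in auto)
  then show ?case by (simp add: insert_commute)
qed

lemma rooted_tree_reroot:
  assumes "rooted_tree r S E" "v \<in> S"
  shows "rooted_tree v S E"
  using assms
proof (induction arbitrary: v)
  case root
  then show ?case by (auto intro: rooted_tree.root)
next
  case (leaf S E p u)
  show ?case
  proof (cases "v = u")
    case True
    then show ?thesis using leaf by (auto intro!: rooted_tree_new_root)
  next
    case False
    then show ?thesis using leaf by (auto intro!: rooted_tree.leaf)
  qed
qed

text \<open>
  Connectedness in the form in which it is used: a nonempty set of vertices that is closed under
  adjacency is everything.
\<close>
lemma rooted_tree_connected:
  assumes "rooted_tree r S E" "A \<noteq> {}" "A \<subseteq> S" "\<And>x y. (x, y) \<in> E \<Longrightarrow> x \<in> A \<Longrightarrow> y \<in> A"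
  shows "A = S"
  using assms
proof (induction arbitrary: A)
  case root
  then show ?case by auto
next
  case (leaf S E p u)
  have "p \<in> A"
  proof (cases "A \<inter> S = {}")
    case True
    then have "u \<in> A" using leaf.prems by auto
    then show ?thesis using leaf.prems(3) by blast
  next
    case False
    have "A \<inter> S = S"
      using leaf.prems(3) rooted_tree_basic(2)[OF leaf.hyps(1)]
      by (intro leaf.IH False) auto
    then show ?thesis using leaf by auto
  qed
  then have "u \<in> A" using leaf.prems(3) by blast
  have "A \<inter> S = S"
    using leaf.prems(3) rooted_tree_basic(2)[OF leaf.hyps(1)] \<open>p \<in> A\<close> leaf.hyps
    by (intro leaf.IH) auto
  then show ?case using \<open>u \<in> A\<close> leaf.prems by auto
qed

lemma rooted_tree_card_arcs:
  assumes "rooted_tree r S E"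
  shows "finite E" "card E + 2 = 2 * card S"
proof -
  show "finite E" using rooted_tree_basic[OF assms] by (meson finite_SigmaI finite_subset)
  show "card E + 2 = 2 * card S" using assms
  proof induction
    case root
    then show ?case by simp
  next
    case (leaf S E p u)
    note b = rooted_tree_basic[OF leaf.hyps(1)]
    have "finite E" using b by (meson finite_SigmaI finite_subset)
    moreover have "(u, p) \<notin> E" "(p, u) \<notin> E" "u \<noteq> p" using b leaf.hyps by auto
    ultimately show ?case using leaf b by auto
  qed
qed

lemma pawalk_snoc:
  assumes "pcas x q p"
  shows "pcas x (q @ [(p, u)]) u" "pawalk_verts x (q @ [(p, u)]) = pawalk_verts x q @ [u]"
  using assms by (induction x q p rule: pcas.induct) auto

lemma rooted_tree_walk:
  assumes "rooted_tree r S E" "x \<in> S" "y \<in> S"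
  shows "\<exists>q. set q \<subseteq> E \<and> pcas x q y \<and> distinct (pawalk_verts x q) \<and> set (pawalk_verts x q) \<subseteq> S"
  using assms
proof (induction arbitrary: x y)
  case root
  then show ?case by (intro exI[of _ "[]"]) auto
next
  case (leaf S E p u)
  consider "x = u" "y = u" | "x = u" "y \<in> S" | "x \<in> S" "y = u" | "x \<in> S" "y \<in> S"
    using leaf.prems by auto
  then show ?case
  proof cases
    case 1
    then show ?thesis by (intro exI[of _ "[]"]) auto
  next
    case 2
    obtain q where "set q \<subseteq> E" "pcas p q y" "distinct (pawalk_verts p q)" "set (pawalk_verts p q) \<subseteq> S"
      using leaf.IH[OF leaf.hyps(2) 2(2)] by blast
    then show ?thesis using 2 leaf.hyps by (intro exI[of _ "(u, p) # q"]) auto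
  next
    case 3
    obtain q where "set q \<subseteq> E" "pcas x q p" "distinct (pawalk_verts x q)" "set (pawalk_verts x q) \<subseteq> S"
      using leaf.IH[OF 3(1) leaf.hyps(2)] by blast
    then show ?thesis using 3 leaf.hyps pawalk_snoc[of x q p u]
      by (intro exI[of _ "q @ [(p, u)]"]) auto
  next
    case 4
    then show ?thesis using leaf.IH[OF 4] by blast
  qed
qed

text \<open>
  A maximal subtree grown from \<open>r\<close> exhausts the tree. Otherwise connectedness yields an edge from some \<open>p\<close>
  inside to some \<open>u\<close> outside. No second vertex inside is adjacent to \<open>u\<close>, since it would close a cycle
  with a walk to \<open>p\<close> inside; hence \<open>u\<close> can be attached as a leaf.
\<close>
lemma undirected_tree_imp_rooted_tree:
  assumes "undirected_tree T" "r \<in> pverts T"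
  shows "rooted_tree r (pverts T) (parcs T)"
proof -
  let ?V = "pverts T" and ?E = "parcs T"
  have pg: "pair_graph T" and con: "connected (with_proj T)"
    and nocyc: "\<And>p. pre_digraph.cycle (with_proj T) p \<Longrightarrow> length p < 3"
    using assms(1) by (auto simp: undirected_tree_def not_le)
  interpret pair_graph T by fact
  have EV: "?E \<subseteq> ?V \<times> ?V" using arc_fst_in_verts arc_snd_in_verts by fastforce
  have symE: "sym ?E" using sym_arcs by (simp add: symmetric_def)
  let ?P = "\<lambda>S. S \<subseteq> ?V \<and> rooted_tree r S (?E \<inter> S \<times> S)"
  have "?E \<inter> {r} \<times> {r} = {}" using pair_no_loops[of "(r, r)"] by auto
  then have P0: "?P {r}" using assms(2) by (simp add: rooted_tree.root)
  obtain S where S: "?P S" and max: "\<And>S'. ?P S' \<Longrightarrow> card S' \<le> card S"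
  proof -
    have "\<forall>S. ?P S \<longrightarrow> card S < Suc (card ?V)"
      by (intro allI impI le_imp_less_Suc card_mono pair_finite_verts) (erule conjunct1)
    from ex_has_greatest_nat[OF P0 this]
    obtain S where "?P S \<and> (\<forall>S'. ?P S' \<longrightarrow> card S' \<le> card S)" by (elim exE)
    then show ?thesis by (intro that[of S]) simp_all
  qed
  note b = rooted_tree_basic[OF conjunct2[OF S]]
  have "S = ?V"
  proof (rule ccontr)
    assume "S \<noteq> ?V"
    then obtain v where v: "v \<in> ?V" "v \<notin> S" using S by auto
    have "\<exists>p u. (p, u) \<in> ?E \<and> p \<in> S \<and> u \<notin> S"
    proof (rule ccontr)
      assume "\<not> ?thesis"
      then have cl: "\<And>p u. (p, u) \<in> ?E \<Longrightarrow> p \<in> S \<Longrightarrow> u \<in> S" by blast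
      have "r \<rightarrow>\<^sup>*\<^bsub>with_proj (mk_symmetric (with_proj T))\<^esub> v"
        using con assms(2) v(1) by (simp add: connected_def strongly_connected_def mk_symmetric_def)
      then have reach: "(r, v) \<in> rtrancl_on (pverts (mk_symmetric (with_proj T))) (parcs (mk_symmetric (with_proj T)))"
        by (simp add: reachable_def)
      have "y \<in> S" if "(x, y) \<in> rtrancl_on F (parcs (mk_symmetric (with_proj T)))" "x \<in> S" for F x y
        using that
      proof (induction rule: rtrancl_on.induct)
        case (rtrancl_on_into_rtrancl_on a b c)
        have "(b, c) \<in> ?E"
          using rtrancl_on_into_rtrancl_on.hyps(2) symE by (auto simp: mk_symmetric_def dest: symD)
        then show ?case using cl rtrancl_on_into_rtrancl_on by blast
      qed
      from this[OF reach b(4)] have "v \<in> S" .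
      then show False using v by simp
    qed
    then obtain p u where pu: "(p, u) \<in> ?E" "p \<in> S" "u \<notin> S" by blast
    have uniq: "p' = p" if p': "(p', u) \<in> ?E" "p' \<in> S" for p'
    proof (rule ccontr)
      assume ne: "p' \<noteq> p"
      obtain q where q: "set q \<subseteq> ?E \<inter> S \<times> S" "pcas p q p'" "distinct (pawalk_verts p q)"
        "set (pawalk_verts p q) \<subseteq> S"
        using rooted_tree_walk[OF conjunct2[OF S] pu(2) p'(2)] by blast
      have "q \<noteq> []" using ne q(2) by auto
      (* q is nonempty, so this closed walk has at least three arcs. *)
    let ?c = "(u, p) # q @ [(p', u)]"
      have "pre_digraph.cycle (with_proj T) ?c"
        unfolding cycle_def awalk_def
        using q pu p' pawalk_snoc[OF q(2), of u] EV symE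
        by (intro exI[of _ u]) (auto simp: sym_def)
      then show False using nocyc[of ?c] \<open>q \<noteq> []\<close> by (cases q) auto
    qed
    have "?E \<inter> insert u S \<times> insert u S = insert (u, p) (insert (p, u) (?E \<inter> S \<times> S))"
    proof -
      have "(u, u) \<notin> ?E" using pair_no_loops[of "(u, u)"] by auto
      moreover have "(u, p) \<in> ?E" using pu symE by (meson symD)
      moreover have "p' = p" if "(u, p') \<in> ?E" "p' \<in> S" for p'
        using uniq that symE by (meson symD)
      ultimately show ?thesis using pu uniq by fast
    qed
    then have "?P (insert u S)" 
      using S pu(2,3) subsetD[OF EV pu(1)] rooted_tree.leaf[of r S "?E \<inter> S \<times> S" p u] by auto
    then have "card (insert u S) \<le> card S" by (rule max)
    then show False using b(1) pu(3) by simp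
  qed
  then show ?thesis using S EV by (simp add: Int_absorb2)
qed

section \<open>Homomorphisms of finite graphs\<close>

definition homs :: "'a set \<Rightarrow> ('a \<times> 'a) set \<Rightarrow> 'b set \<Rightarrow> ('b \<times> 'b) set \<Rightarrow> ('a \<Rightarrow> 'b) set" where
  "homs S D V E = {f \<in> S \<rightarrow>\<^sub>E V. \<forall>u v. (u, v) \<in> D \<longrightarrow> (f u, f v) \<in> E}"

lemma End_eq_homs: "End G = homs (pverts G) (parcs G) (pverts G) (parcs G)"
  by (simp add: End_def homs_def)

lemma mem_homs_iff:
  "f \<in> homs S D V E \<longleftrightarrow> (\<forall>x\<in>S. f x \<in> V) \<and> (\<forall>x. x \<notin> S \<longrightarrow> f x = undefined) \<and>
     (\<forall>u v. (u, v) \<in> D \<longrightarrow> (f u, f v) \<in> E)"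
  by (auto simp: homs_def PiE_def Pi_def extensional_def)

text \<open>
  The weighted inequality of the arithmetic and geometric means for \<open>a\<close> copies of \<open>x^(a + 1)\<close> and one
  copy of \<open>y^(a + 1)\<close>.
\<close>
lemma power_times_le:
  fixes x y :: real
  assumes "x \<ge> 0" "y \<ge> 0"
  shows "real (Suc a) * (x ^ a * y) \<le> real a * x ^ Suc a + y ^ Suc a"
proof (induction a)
  case 0
  then show ?case by simp
next
  case (Suc a)
  have "0 \<le> (x - y) * (x ^ Suc a - y ^ Suc a)"
  proof (cases "x \<le> y")
    case True
    then have "x ^ Suc a \<le> y ^ Suc a" using assms by (intro power_mono) auto
    then show ?thesis using True by (intro mult_nonpos_nonpos) auto
  next
    case False
    then have "y ^ Suc a \<le> x ^ Suc a" using assms by (intro power_mono) auto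
    then show ?thesis using False by (intro mult_nonneg_nonneg) auto
  qed
  then have e: "x * y ^ Suc a + x ^ Suc a * y \<le> x ^ Suc (Suc a) + y ^ Suc (Suc a)"
    by (simp add: algebra_simps)
  have "x * (real (Suc a) * (x ^ a * y)) \<le> x * (real a * x ^ Suc a + y ^ Suc a)"
    using Suc assms by (intro mult_left_mono) auto
  then show ?case using e by (simp add: algebra_simps)
qed

locale finite_graph =
  fixes V :: "'b set" and E :: "('b \<times> 'b) set"
  assumes finite_V: "finite V" and arcs_in: "E \<subseteq> V \<times> V" and sym_E: "sym E"
begin

lemma finite_nbrs [simp, intro]: "finite (E `` {x})"
  by (rule finite_subset[OF _ finite_V]) (use arcs_in in auto)

lemma finite_homs: "finite S \<Longrightarrow> finite (homs S D V E)"
  by (rule finite_subset[of _ "S \<rightarrow>\<^sub>E V"]) (auto simp: homs_def finite_V intro!: finite_PiE)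

text \<open>
  The base of every count: a single vertex may be sent anywhere.
\<close>
lemma sum_homs_root:
  fixes F :: "'b \<Rightarrow> real"
  shows "(\<Sum>f\<in>homs {r} {} V E. F (f r)) = (\<Sum>x\<in>V. F x)"
proof -
  have "bij_betw (\<lambda>f. f r) (homs {r} {} V E) V"
    by (rule bij_betwI[where g = "\<lambda>x. \<lambda>i\<in>{r}. x"])
      (auto simp: homs_def PiE_def extensional_def fun_eq_iff)
  then show ?thesis by (rule sum.reindex_bij_betw)
qed

text \<open>
  A homomorphism of the larger tree is a homomorphism \<open>f\<close> of the smaller one together with a neighbour
  of \<open>f p\<close>.
\<close>
lemma sum_homs_leaf:
  fixes F :: "('a \<Rightarrow> 'b) \<Rightarrow> real"
  assumes "finite S" "D \<subseteq> S \<times> S" "p \<in> S" "u \<notin> S"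
  shows "(\<Sum>f\<in>homs (insert u S) (insert (u, p) (insert (p, u) D)) V E. F f) =
    (\<Sum>f\<in>homs S D V E. \<Sum>y\<in>E `` {f p}. F (f(u := y)))"
proof -
  have D_neq: "x \<noteq> u" "x' \<noteq> u" if "(x, x') \<in> D" for x x'
    using that assms(2,4) by auto
  have "bij_betw (\<lambda>(f, y). f(u := y)) (SIGMA f:homs S D V E. E `` {f p})
    (homs (insert u S) (insert (u, p) (insert (p, u) D)) V E)"
  proof (rule bij_betwI[where g = "\<lambda>f. (f(u := undefined), f u)"], goal_cases)
    case 1
    have "f(u := y) \<in> homs (insert u S) (insert (u, p) (insert (p, u) D)) V E"
      if f: "f \<in> homs S D V E" and y: "(f p, y) \<in> E" for f y
    proof -
      have "y \<in> V" "(y, f p) \<in> E" using y arcs_in sym_E by (auto dest: symD)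
      moreover have "p \<noteq> u" using assms by auto
      ultimately show ?thesis using f y D_neq by (simp add: mem_homs_iff)
    qed
    then show ?case by auto
  next
    case 2
    have "f(u := undefined) \<in> homs S D V E" "(f p, f u) \<in> E"
      if f: "f \<in> homs (insert u S) (insert (u, p) (insert (p, u) D)) V E" for f
      using f D_neq assms(4) by (auto simp: mem_homs_iff)
    moreover have "p \<noteq> u" using assms by auto
    ultimately show ?case by simp
  next
    case (3 z)
    then have "fst z u = undefined" using assms(4) by (auto simp: mem_homs_iff)
    then show ?case by (cases z) (simp add: fun_upd_idem)
  next
    case (4 y)
    then show ?case by simp
  qed
  then have "(\<Sum>f\<in>homs (insert u S) (insert (u, p) (insert (p, u) D)) V E. F f) =
     (\<Sum>(f, y)\<in>(SIGMA f:homs S D V E. E `` {f p}). F (f(u := y)))"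
    by (subst sum.reindex_bij_betw[symmetric]) (auto simp: case_prod_unfold)
  also have "\<dots> = (\<Sum>f\<in>homs S D V E. \<Sum>y\<in>E `` {f p}. F (f(u := y)))"
    by (subst sum.Sigma) (auto simp: finite_homs assms)
  finally show ?thesis .
qed

definition deg :: "'b \<Rightarrow> nat" where
  "deg x = card (E `` {x})"

lemma sum_swap_nbrs:
  fixes g :: "'b \<Rightarrow> 'b \<Rightarrow> real"
  shows "(\<Sum>x\<in>V. \<Sum>y\<in>E `` {x}. g x y) = (\<Sum>y\<in>V. \<Sum>x\<in>E `` {y}. g x y)"
proof -
  have "(\<Sum>x\<in>V. \<Sum>y\<in>E `` {x}. g x y) = (\<Sum>x\<in>V. \<Sum>y\<in>V. if (x, y) \<in> E then g x y else 0)"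
    using arcs_in by (intro sum.cong sum.mono_neutral_cong_left refl finite_V) auto
  also have "\<dots> = (\<Sum>y\<in>V. \<Sum>x\<in>V. if (x, y) \<in> E then g x y else 0)"
    by (rule sum.swap)
  also have "\<dots> = (\<Sum>y\<in>V. \<Sum>x\<in>E `` {y}. g x y)"
    using arcs_in sym_E by (intro sum.cong sum.mono_neutral_cong_right refl finite_V) (auto simp: sym_def)
  finally show ?thesis .
qed

lemma sum_deg: "(\<Sum>x\<in>V. deg x) = card E"
proof -
  have "card (SIGMA x:V. E `` {x}) = (\<Sum>x\<in>V. deg x)"
    unfolding deg_def by (subst card_SigmaI) (auto simp: finite_V)
  moreover have "(SIGMA x:V. E `` {x}) = E" using arcs_in by auto
  ultimately show ?thesis by simp
qed

section \<open>The star bound\<close>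

text \<open>
  The extra factor, a power of the degree of the image of \<open>v\<close>, makes the induction work. Deleting a leaf
  attached to \<open>p\<close> leaves a factor \<open>deg (f p)\<close>; the product with \<open>deg (f v) ^ a\<close> is split by
  \<open>power_times_le\<close> into terms that depend on \<open>f v\<close> alone or on \<open>f p\<close> alone, and the induction hypothesis
  applies to both after rerooting the smaller tree at \<open>v\<close> or at \<open>p\<close>.
\<close>
lemma sum_homs_le_sum_deg:
  assumes "rooted_tree v S D"
  shows "(\<Sum>f\<in>homs S D V E. real (deg (f v)) ^ a) \<le> (\<Sum>x\<in>V. real (deg x) ^ (a + card S - 1))"
  using assms
proof (induction "card S" arbitrary: v S D a)
  case 0
  then show ?case using rooted_tree_basic[OF 0(2)] by auto
next
  case (Suc k)
  from Suc.prems show ?case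
  proof cases
    case root
    then show ?thesis using sum_homs_root[where r = v and F = "\<lambda>x. real (deg x) ^ a"] by simp
  next
    case (leaf S' D' p u)
    note b = rooted_tree_basic[OF leaf(3)]
    have vu: "v \<noteq> u" using b(4) leaf by auto
    have k: "k = card S'" using Suc(2) b(1) leaf by auto
    have S'pos: "card S' > 0" using b by (auto simp: card_gt_0_iff)
    have tp: "rooted_tree p S' D'" using rooted_tree_reroot leaf by metis
    have "real (Suc a) * (\<Sum>f\<in>homs S D V E. real (deg (f v)) ^ a)
      = real (Suc a) * (\<Sum>f\<in>homs S' D' V E. real (deg (f v)) ^ a * real (deg (f p)))"
      unfolding leaf using sum_homs_leaf[OF b(1,2) leaf(4,5), of "\<lambda>f. real (deg (f v)) ^ a"] vu
      by (simp add: deg_def mult.commute)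
    also have "\<dots> = (\<Sum>f\<in>homs S' D' V E. real (Suc a) * (real (deg (f v)) ^ a * real (deg (f p))))"
      by (rule sum_distrib_left)
    also have "\<dots> \<le> (\<Sum>f\<in>homs S' D' V E. real a * real (deg (f v)) ^ Suc a + real (deg (f p)) ^ Suc a)"
      by (intro sum_mono power_times_le) auto
    also have "\<dots> = real a * (\<Sum>f\<in>homs S' D' V E. real (deg (f v)) ^ Suc a)
        + (\<Sum>f\<in>homs S' D' V E. real (deg (f p)) ^ Suc a)"
      by (simp add: sum.distrib sum_distrib_left)
    also have "\<dots> \<le> real a * (\<Sum>x\<in>V. real (deg x) ^ (Suc a + card S' - 1))
        + (\<Sum>x\<in>V. real (deg x) ^ (Suc a + card S' - 1))"
      using Suc.hyps(1)[OF k leaf(3), of "Suc a"] Suc.hyps(1)[OF k tp, of "Suc a"]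
      by (intro add_mono mult_left_mono) auto
    also have "Suc a + card S' - 1 = a + card S - 1"
      using leaf b(1) S'pos by auto
    finally have "real (Suc a) * (\<Sum>f\<in>homs S D V E. real (deg (f v)) ^ a)
      \<le> real (Suc a) * (\<Sum>x\<in>V. real (deg x) ^ (a + card S - 1))"
      by (simp add: algebra_simps)
    then show ?thesis by (subst (asm) mult_le_cancel_left_pos) auto
  qed
qed

corollary card_homs_le_sum_deg:
  assumes "rooted_tree v S D"
  shows "real (card (homs S D V E)) \<le> (\<Sum>x\<in>V. real (deg x) ^ (card S - 1))"
  using sum_homs_le_sum_deg[OF assms, of 0] by simp

end

lemma star_graph_rooted_tree:
  "rooted_tree 0 {..<Suc k} (parcs (star_graph (Suc k)))"
proof (induction k)
  case 0
  have "parcs (star_graph (Suc 0)) = {}" "{..<Suc 0} = {0}" by (auto simp: star_graph_def)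
  then show ?case by (simp add: rooted_tree.root)
next
  case (Suc k)
  have "parcs (star_graph (Suc (Suc k))) =
    insert (Suc k, 0) (insert (0, Suc k) (parcs (star_graph (Suc k))))"
    by (auto simp: star_graph_def less_Suc_eq)
  moreover have "{..<Suc (Suc k)} = insert (Suc k) {..<Suc k}" by auto
  ultimately show ?case using rooted_tree.leaf[OF Suc, of 0 "Suc k"] by simp
qed

text \<open>
  The case of equality in the star bound: every leaf of the star is attached to the centre, so that the
  centre collects all factors.
\<close>
lemma (in finite_graph) sum_homs_star:
  "(\<Sum>f\<in>homs {..<Suc k} (parcs (star_graph (Suc k))) V E. real (deg (f 0)) ^ a)
     = (\<Sum>x\<in>V. real (deg x) ^ (a + k))"
proof (induction k arbitrary: a)
  case 0
  have "parcs (star_graph (Suc 0)) = {}" "{..<Suc 0} = {0::nat}" by (auto simp: star_graph_def)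
  then show ?case using sum_homs_root[where r = "0::nat" and F = "\<lambda>x. real (deg x) ^ a"] by simp
next
  case (Suc k)
  note b = rooted_tree_basic[OF star_graph_rooted_tree[of k]]
  have e: "parcs (star_graph (Suc (Suc k))) =
    insert (Suc k, 0) (insert (0, Suc k) (parcs (star_graph (Suc k))))"
    by (auto simp: star_graph_def less_Suc_eq)
  have v: "{..<Suc (Suc k)} = insert (Suc k) {..<Suc k}" by auto
  have "(\<Sum>f\<in>homs {..<Suc (Suc k)} (parcs (star_graph (Suc (Suc k)))) V E. real (deg (f 0)) ^ a)
    = (\<Sum>f\<in>homs {..<Suc k} (parcs (star_graph (Suc k))) V E. real (deg (f 0)) ^ Suc a)"
    unfolding e v by (subst sum_homs_leaf[OF b(1,2)]) (auto simp: deg_def)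
  also have "\<dots> = (\<Sum>x\<in>V. real (deg x) ^ (a + Suc k))" using Suc[of "Suc a"] by simp
  finally show ?case .
qed

lemma finite_graph_star: "finite_graph {..<n} (parcs (star_graph n))"
  by unfold_locales (auto simp: star_graph_def sym_def)

lemma card_End_star:
  assumes "n \<ge> 2"
  shows "real (card (End (star_graph n))) = real (n - 1) ^ (n - 1) + real (n - 1)"
proof -
  obtain k where n: "n = Suc k" "k > 0" using assms by (cases n) auto
  interpret finite_graph "{..<n}" "parcs (star_graph n)" by (rule finite_graph_star)
  have d0: "deg 0 = k"
  proof -
    have "parcs (star_graph n) `` {0} = {1..k}" using n by (auto simp: star_graph_def)
    then show ?thesis by (simp add: deg_def)
  qed
  have d1: "deg x = 1" if "x \<in> {1..k}" for x
  proof -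
    have "parcs (star_graph n) `` {x} = {0}" using n that by (auto simp: star_graph_def)
    then show ?thesis by (simp add: deg_def)
  qed
  have "real (card (End (star_graph n))) = (\<Sum>x<n. real (deg x) ^ k)"
  proof -
    have "pverts (star_graph n) = {..<n}" by (simp add: star_graph_def)
    then have "real (card (End (star_graph n))) =
        (\<Sum>f\<in>homs {..<Suc k} (parcs (star_graph (Suc k))) {..<n} (parcs (star_graph n)). real (deg (f 0)) ^ 0)"
      unfolding End_eq_homs n(1)[symmetric] by simp
    also have "\<dots> = (\<Sum>x<n. real (deg x) ^ (0 + k))" by (rule sum_homs_star)
    finally show ?thesis by simp
  qed
  also have "{..<n} = insert 0 {1..k}" using n by auto
  also have "(\<Sum>x\<in>insert 0 {1..k}. real (deg x) ^ k) = real k ^ k + (\<Sum>x\<in>{1..k}. real (deg x) ^ k)"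
    by (simp add: d0)
  also have "(\<Sum>x\<in>{1..k}. real (deg x) ^ k) = (\<Sum>x\<in>{1..k}. 1)"
    by (rule sum.cong) (auto simp: d1)
  finally show ?thesis using n by simp
qed

section \<open>Trees as targets, and the upper bound\<close>

text \<open>
  The tree is used in its grown form, from an arbitrary root.
\<close>
locale tree_graph = finite_graph V E for V :: "'b set" and E +
  assumes grown: "\<And>v. v \<in> V \<Longrightarrow> rooted_tree v V E" and nonempty: "V \<noteq> {}"
begin

lemma no_loop: "(x, x) \<notin> E"
proof -
  obtain v where "v \<in> V" using nonempty by blast
  from rooted_tree_basic(5)[OF grown[OF this]] show ?thesis .
qed

lemma sum_deg_tree: "(\<Sum>x\<in>V. deg x) + 2 = 2 * card V"
proof -
  obtain v where "v \<in> V" using nonempty by blast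
  from rooted_tree_card_arcs(2)[OF grown[OF this]] show ?thesis by (simp add: sum_deg)
qed

lemma closed_eq_V:
  assumes "A \<noteq> {}" "A \<subseteq> V" "\<And>x y. (x, y) \<in> E \<Longrightarrow> x \<in> A \<Longrightarrow> y \<in> A"
  shows "A = V"
proof -
  obtain v where "v \<in> V" using nonempty by blast
  from rooted_tree_connected[OF grown[OF this] assms] show ?thesis .
qed

lemma deg_pos:
  assumes "card V \<ge> 2" "x \<in> V"
  shows "deg x \<ge> 1"
proof (rule ccontr)
  assume "\<not> ?thesis"
  then have "E `` {x} = {}" using finite_nbrs[of x] by (simp add: deg_def not_le)
  then have "\<And>y z. (y, z) \<in> E \<Longrightarrow> y \<in> {x} \<Longrightarrow> z \<in> {x}" by auto
  then have "{x} = V" using assms(2) by (intro closed_eq_V) simp_all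
  from arg_cong[OF this, of card] show False using assms(1) by simp
qed

lemma deg_le: assumes "x \<in> V" shows "deg x \<le> card V - 1"
proof -
  have "E `` {x} \<subseteq> V - {x}" using arcs_in no_loop by auto
  then have "deg x \<le> card (V - {x})" unfolding deg_def using finite_V by (intro card_mono) auto
  then show ?thesis using assms finite_V by simp
qed

text \<open>
  Convexity of the power function on \<open>[1, n - 1]\<close>, in the guise of \<open>t^k - 1 = (t - 1) (1 + t + \<dots> + t^(k - 1))\<close>:
  the second factor is largest at \<open>t = n - 1\<close>, and the first factors add up to \<open>n - 2\<close>.
\<close>
lemma sum_deg_power_le:
  assumes "card V \<ge> 2"
  shows "(\<Sum>x\<in>V. real (deg x) ^ k) \<le> real (card V - 1) ^ k + real (card V - 1)"
proof -
  define M where "M = real (card V - 1)"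
  define G where "G = (\<Sum>i<k. M ^ i)"
  have "real (deg x) ^ k - 1 \<le> (real (deg x) - 1) * G" if "x \<in> V" for x
  proof -
    have "real (deg x) \<le> M" unfolding M_def using deg_le[OF that] by simp
    then have "(\<Sum>i<k. real (deg x) ^ i) \<le> G"
      unfolding G_def by (intro sum_mono power_mono) auto
    then have "(real (deg x) - 1) * (\<Sum>i<k. real (deg x) ^ i) \<le> (real (deg x) - 1) * G"
      using deg_pos[OF assms that] by (intro mult_left_mono) auto
    then show ?thesis by (simp add: power_diff_1_eq)
  qed
  then have "(\<Sum>x\<in>V. real (deg x) ^ k - 1) \<le> (\<Sum>x\<in>V. (real (deg x) - 1) * G)"
    by (intro sum_mono)
  also have "\<dots> = (real (\<Sum>x\<in>V. deg x) - real (card V)) * G"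
    by (simp add: sum_distrib_right[symmetric] sum_subtractf)
  also have "real (\<Sum>x\<in>V. deg x) - real (card V) = M - 1"
    using sum_deg_tree assms unfolding M_def by linarith
  also have "(M - 1) * G = M ^ k - 1" by (simp add: G_def power_diff_1_eq)
  finally show ?thesis using assms by (simp add: sum_subtractf M_def)
qed

lemma card_homs_self_le:
  assumes "card V \<ge> 2"
  shows "real (card (homs V E V E)) \<le> real (card V - 1) ^ (card V - 1) + real (card V - 1)"
proof -
  obtain v where "v \<in> V" using nonempty by blast
  from card_homs_le_sum_deg[OF grown[OF this]] sum_deg_power_le[OF assms, of "card V - 1"]
  show ?thesis by linarith
qed

end

lemma rooted_tree_tree_graph:
  assumes "rooted_tree r V E" shows "tree_graph V E"
  using rooted_tree_basic[OF assms] rooted_tree_reroot[OF assms]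
  by unfold_locales auto

section \<open>Trees without branching\<close>

text \<open>
  Conjugation by the isomorphism \<open>p\<close> carries endomorphisms injectively to endomorphisms.
\<close>
lemma card_homs_le_of_bij:
  assumes p: "bij_betw p N V" and D: "D \<subseteq> N \<times> N" and E: "E = (\<lambda>(i, j). (p i, p j)) ` D"
    and fin: "finite V"
  shows "card (homs N D N D) \<le> card (homs V E V E)"
proof -
  define q where "q = inv_into N p"
  have q: "q x \<in> N" "p (q x) = x" if "x \<in> V" for x
    using that p by (auto simp: q_def bij_betw_def inv_into_into f_inv_into_f)
  have qp: "q (p i) = i" and pV: "p i \<in> V" if "i \<in> N" for i
    using that p by (auto simp: q_def bij_betw_def)
  define \<Phi> where "\<Phi> f = (\<lambda>x\<in>V. p (f (q x)))" for f
  have "inj_on \<Phi> (homs N D N D)"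
  proof (rule inj_onI)
    fix f g assume f: "f \<in> homs N D N D" and g: "g \<in> homs N D N D" and eq: "\<Phi> f = \<Phi> g"
    show "f = g"
    proof
      fix i
      show "f i = g i"
      proof (cases "i \<in> N")
        case True
        have "p (f i) = p (g i)"
          using fun_cong[OF eq, of "p i"] pV[OF True] qp[OF True] by (simp add: \<Phi>_def)
        moreover have "f i \<in> N" "g i \<in> N" using f g True by (auto simp: mem_homs_iff)
        ultimately show ?thesis using qp by metis
      next
        case False
        then show ?thesis using f g by (simp add: mem_homs_iff)
      qed
    qed
  qed
  moreover have "\<Phi> ` homs N D N D \<subseteq> homs V E V E"
  proof clarify
    fix f assume f: "f \<in> homs N D N D"
    have "(\<Phi> f x, \<Phi> f y) \<in> E" if xy: "(x, y) \<in> E" for x y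
    proof -
      obtain i j where ij: "(i, j) \<in> D" "x = p i" "y = p j" using xy E by auto
      then have "i \<in> N" "j \<in> N" using D by auto
      then have "\<Phi> f x = p (f i)" "\<Phi> f y = p (f j)" using ij qp pV by (auto simp: \<Phi>_def)
      moreover have "(f i, f j) \<in> D" using f ij by (auto simp: mem_homs_iff)
      ultimately show ?thesis using E by force
    qed
    moreover have "\<Phi> f x \<in> V" if "x \<in> V" for x
      using f q(1)[OF that] pV that by (auto simp: mem_homs_iff \<Phi>_def)
    moreover have "\<Phi> f x = undefined" if "x \<notin> V" for x
      using that by (simp add: \<Phi>_def)
    ultimately show "\<Phi> f \<in> homs V E V E" by (simp add: mem_homs_iff)
  qed
  moreover have "finite (homs V E V E)"
    by (rule finite_subset[of _ "V \<rightarrow>\<^sub>E V"]) (auto simp: homs_def fin intro!: finite_PiE)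
  ultimately show ?thesis by (rule card_inj_on_le)
qed

lemma path_graph_simps [simp]:
  "pverts (path_graph n) = {..<n}"
  "(i, j) \<in> parcs (path_graph n) \<longleftrightarrow> i < n \<and> j < n \<and> (j = Suc i \<or> i = Suc j)"
  by (auto simp: path_graph_def)

lemma parcs_path_graph_Suc:
  "parcs (path_graph (Suc (Suc k))) = insert (Suc k, k) (insert (k, Suc k) (parcs (path_graph (Suc k))))"
  by (auto simp: less_Suc_eq)

lemma path_graph_rooted_tree: "rooted_tree 0 {..<Suc k} (parcs (path_graph (Suc k)))"
proof (induction k)
  case 0
  have "parcs (path_graph (Suc 0)) = {}" "{..<Suc 0} = {0}" by auto
  then show ?case by (simp add: rooted_tree.root)
next
  case (Suc k)
  have "{..<Suc (Suc k)} = insert (Suc k) {..<Suc k}" by auto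
  then show ?case using rooted_tree.leaf[OF Suc, of k "Suc k"] by (simp add: parcs_path_graph_Suc)
qed

text \<open>
  A path may be enumerated from its other end; this is what allows a new vertex, or the shorter leg of a
  spider, to be assumed at a prescribed end.
\<close>
lemma path_enumeration_rev:
  assumes "bij_betw p {..<m} S" "E = (\<lambda>(i, j). (p i, p j)) ` parcs (path_graph m)"
  shows "bij_betw (\<lambda>i. p (m - Suc i)) {..<m} S"
    "E = (\<lambda>(i, j). (p (m - Suc i), p (m - Suc j))) ` parcs (path_graph m)"
proof -
  have rev: "bij_betw (\<lambda>i. m - Suc i) {..<m} {..<m}"
    by (rule bij_betwI[where g = "\<lambda>i. m - Suc i"]) auto
  show "bij_betw (\<lambda>i. p (m - Suc i)) {..<m} S"
    using bij_betw_trans[OF rev assms(1)] by (simp add: o_def)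
  have "parcs (path_graph m) = (\<lambda>(i, j). (m - Suc i, m - Suc j)) ` parcs (path_graph m)"
  proof (intro equalityI subsetI)
    fix e assume e: "e \<in> parcs (path_graph m)"
    obtain i j where ij: "e = (i, j)" by (cases e)
    have "(m - Suc i, m - Suc j) \<in> parcs (path_graph m)" "m - Suc (m - Suc i) = i" "m - Suc (m - Suc j) = j"
      using e ij by auto
    then show "e \<in> (\<lambda>(i, j). (m - Suc i, m - Suc j)) ` parcs (path_graph m)"
      using ij by (intro image_eqI[of _ _ "(m - Suc i, m - Suc j)"]) auto
  qed auto
  then have "E = (\<lambda>(i, j). (p i, p j)) ` (\<lambda>(i, j). (m - Suc i, m - Suc j)) ` parcs (path_graph m)"
    using assms(2) by simp
  then show "E = (\<lambda>(i, j). (p (m - Suc i), p (m - Suc j))) ` parcs (path_graph m)"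
    by (simp add: image_image case_prod_unfold)
qed

lemma path_enumeration_snoc:
  assumes "bij_betw p {..<Suc k} S" "E = (\<lambda>(i, j). (p i, p j)) ` parcs (path_graph (Suc k))" "u \<notin> S"
  shows "bij_betw (p(Suc k := u)) {..<Suc (Suc k)} (insert u S)"
    "insert (u, p k) (insert (p k, u) E)
      = (\<lambda>(i, j). ((p(Suc k := u)) i, (p(Suc k := u)) j)) ` parcs (path_graph (Suc (Suc k)))"
proof -
  have "bij_betw (p(Suc k := u)) {..<Suc k} S"
    using assms(1) by (subst bij_betw_cong[of _ _ p]) auto
  then show "bij_betw (p(Suc k := u)) {..<Suc (Suc k)} (insert u S)"
    using notIn_Un_bij_betw[of "Suc k" "{..<Suc k}" "p(Suc k := u)" S] assms(3)
    by (simp add: lessThan_Suc[of "Suc k"])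
  have "(\<lambda>(i, j). ((p(Suc k := u)) i, (p(Suc k := u)) j)) ` parcs (path_graph (Suc k)) = E"
    unfolding assms(2) by (rule image_cong) auto
  then show "insert (u, p k) (insert (p k, u) E)
      = (\<lambda>(i, j). ((p(Suc k := u)) i, (p(Suc k := u)) j)) ` parcs (path_graph (Suc (Suc k)))"
    unfolding parcs_path_graph_Suc by simp
qed

text \<open>
  Along the growth of the tree, the vertex to which a new leaf is attached had degree at most one before,
  so it is an end of the path built so far.
\<close>
lemma max_deg_two_path:
  assumes "rooted_tree r S E" "\<And>x. x \<in> S \<Longrightarrow> card (E `` {x}) \<le> 2"
  shows "\<exists>p. bij_betw p {..<card S} S \<and> E = (\<lambda>(i, j). (p i, p j)) ` parcs (path_graph (card S))"
  using assms
proof induction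
  case root
  have "parcs (path_graph (Suc 0)) = {}" "{..<Suc 0} = {0}" by auto
  then show ?case by (intro exI[of _ "\<lambda>_. r"]) (simp add: bij_betw_def)
next
  case (leaf S E a u)
  note b = rooted_tree_basic[OF leaf.hyps(1)]
  have finE: "finite (E `` {x})" for x using b(2) by (intro finite_subset[OF _ b(1)]) auto
  let ?E' = "insert (u, a) (insert (a, u) E)"
  have deg: "card (E `` {x}) \<le> 2" if "x \<in> S" for x
  proof -
    have "finite (?E' `` {x})" 
      by (rule finite_subset[of _ "insert u S"]) (use b(1,2) leaf.hyps(2) in auto)
    then have "card (E `` {x}) \<le> card (?E' `` {x})" by (intro card_mono) auto
    also have "\<dots> \<le> 2" using leaf.prems[of x] that by simp
    finally show ?thesis .
  qed
  obtain k where k: "card S = Suc k" using b(1,4) by (metis card_gt_0_iff empty_iff gr0_conv_Suc)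
  obtain p where p: "bij_betw p {..<Suc k} S" "E = (\<lambda>(i, j). (p i, p j)) ` parcs (path_graph (Suc k))"
    using leaf.IH[OF deg] k by auto
  obtain i where i: "i < Suc k" "a = p i" using p(1) leaf.hyps(2) by (auto simp: bij_betw_def)
  have "card (E `` {a}) \<le> 1"
  proof -
    have "?E' `` {a} = insert u (E `` {a})" using leaf.hyps by auto
    moreover have "u \<notin> E `` {a}" using b(2) leaf.hyps(3) by auto
    ultimately have "card (?E' `` {a}) = Suc (card (E `` {a}))" using finE by simp
    then show ?thesis using leaf.prems[of a] leaf.hyps by simp
  qed
  have "i = 0 \<or> i = k"
  proof (rule ccontr)
    assume c: "\<not> (i = 0 \<or> i = k)"
    then have "(i, i - 1) \<in> parcs (path_graph (Suc k))" "(i, Suc i) \<in> parcs (path_graph (Suc k))"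
      using i by auto
    then have "{p (i - 1), p (Suc i)} \<subseteq> E `` {a}" using p(2) i(2) by force
    then have "card {p (i - 1), p (Suc i)} \<le> card (E `` {a})" using finE by (intro card_mono)
    moreover have "p (i - 1) \<noteq> p (Suc i)"
      using p(1) i c by (auto simp: bij_betw_def inj_on_eq_iff)
    ultimately show False using \<open>card (E `` {a}) \<le> 1\<close> by simp
  qed
  then have "\<exists>p. bij_betw p {..<Suc k} S \<and> E = (\<lambda>(i, j). (p i, p j)) ` parcs (path_graph (Suc k)) \<and> a = p k"
  proof
    assume "i = k" then show ?thesis using p i by blast
  next
    assume "i = 0"
    then show ?thesis using path_enumeration_rev[OF p] i
      by (intro exI[of _ "\<lambda>i. p (Suc k - Suc i)"]) simp
  qed
  then obtain p where p: "bij_betw p {..<Suc k} S" "E = (\<lambda>(i, j). (p i, p j)) ` parcs (path_graph (Suc k))"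
    "a = p k" by blast
  have "card (insert u S) = Suc (Suc k)" using b(1) leaf.hyps(3) k by simp
  then show ?case
    using path_enumeration_snoc[OF p(1,2) leaf.hyps(3), folded p(3)] by metis
qed

section \<open>Counting walks\<close>

context finite_graph begin

definition nbr_sum :: "('b \<Rightarrow> real) \<Rightarrow> 'b \<Rightarrow> real" where
  "nbr_sum g x = (\<Sum>y\<in>E `` {x}. g y)"

definition walks :: "nat \<Rightarrow> 'b \<Rightarrow> real" where
  "walks k = (nbr_sum ^^ k) (\<lambda>_. 1)"

lemma walks_0 [simp]: "walks 0 x = 1"
  and walks_Suc: "walks (Suc k) x = (\<Sum>y\<in>E `` {x}. walks k y)"
  by (simp_all add: walks_def nbr_sum_def)

lemma walks_nonneg: "walks k x \<ge> 0"
  by (induction k arbitrary: x) (auto simp: walks_Suc intro: sum_nonneg)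

lemma walks_1: "walks (Suc 0) x = real (deg x)"
  by (simp add: walks_Suc deg_def)

text \<open>
  \<open>nbr_sum\<close> is the adjacency operator, which is self-adjoint because the graph is undirected.
\<close>
lemma nbr_sum_adjoint: "(\<Sum>x\<in>V. g x * nbr_sum h x) = (\<Sum>x\<in>V. nbr_sum g x * h x)"
  using sum_swap_nbrs[of "\<lambda>x y. g x * h y"]
  by (simp add: nbr_sum_def sum_distrib_left sum_distrib_right)

lemma nbr_sum_funpow_adjoint:
  "(\<Sum>x\<in>V. g x * (nbr_sum ^^ k) h x) = (\<Sum>x\<in>V. (nbr_sum ^^ k) g x * h x)"
proof (induction k arbitrary: g)
  case (Suc k)
  have "(\<Sum>x\<in>V. g x * (nbr_sum ^^ Suc k) h x) = (\<Sum>x\<in>V. nbr_sum g x * (nbr_sum ^^ k) h x)"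
    by (simp add: nbr_sum_adjoint)
  also have "\<dots> = (\<Sum>x\<in>V. (nbr_sum ^^ Suc k) g x * h x)"
    by (simp add: Suc funpow_swap1)
  finally show ?case .
qed simp

text \<open>
  The last \<open>b\<close> vertices of the path are peeled off, each of them acting by the adjacency operator.
\<close>
lemma sum_homs_path_end:
  "(\<Sum>f\<in>homs {..<Suc (c + b)} (parcs (path_graph (Suc (c + b)))) V E. g (f c) * h (f (c + b)))
    = (\<Sum>f\<in>homs {..<Suc c} (parcs (path_graph (Suc c))) V E. g (f c) * (nbr_sum ^^ b) h (f c))"
proof (induction b arbitrary: h)
  case (Suc b)
  note bs = rooted_tree_basic[OF path_graph_rooted_tree[of "c + b"]]
  have v: "{..<Suc (Suc (c + b))} = insert (Suc (c + b)) {..<Suc (c + b)}" by auto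
  have "(\<Sum>f\<in>homs {..<Suc (Suc (c + b))} (parcs (path_graph (Suc (Suc (c + b))))) V E. g (f c) * h (f (Suc (c + b))))
    = (\<Sum>f\<in>homs {..<Suc (c + b)} (parcs (path_graph (Suc (c + b)))) V E. g (f c) * nbr_sum h (f (c + b)))"
    unfolding v parcs_path_graph_Suc
    by (subst sum_homs_leaf[OF bs(1,2)]) (auto simp: nbr_sum_def sum_distrib_left)
  also have "\<dots> = (\<Sum>f\<in>homs {..<Suc c} (parcs (path_graph (Suc c))) V E. g (f c) * (nbr_sum ^^ Suc b) h (f c))"
    by (simp add: Suc funpow_swap1)
  finally show ?case by simp
qed simp

text \<open>
  A homomorphism of a path is a pair of walks that start at the image of the vertex \<open>c\<close>.
\<close>
lemma sum_homs_path:
  "(\<Sum>f\<in>homs {..<Suc (c + b)} (parcs (path_graph (Suc (c + b)))) V E. g (f c))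
    = (\<Sum>x\<in>V. walks c x * (g x * walks b x))"
proof -
  have e: "parcs (path_graph (Suc 0)) = {}" "{..<Suc 0} = {0::nat}" by auto
  have "(\<Sum>f\<in>homs {..<Suc (c + b)} (parcs (path_graph (Suc (c + b)))) V E. g (f c))
    = (\<Sum>f\<in>homs {..<Suc c} (parcs (path_graph (Suc c))) V E. g (f c) * walks b (f c))"
    using sum_homs_path_end[where g = g and h = "\<lambda>_. 1" and c = c and b = b] by (simp add: walks_def)
  also have "\<dots> = (\<Sum>f\<in>homs {0::nat} {} V E. (nbr_sum ^^ c) (\<lambda>x. g x * walks b x) (f 0))"
    using sum_homs_path_end[where g = "\<lambda>_. 1" and h = "\<lambda>x. g x * walks b x" and c = 0 and b = c] by (simp only: e add_0 mult_1)
  also have "\<dots> = (\<Sum>x\<in>V. 1 * (nbr_sum ^^ c) (\<lambda>x. g x * walks b x) x)"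
    by (simp only: sum_homs_root mult_1)
  also have "\<dots> = (\<Sum>x\<in>V. walks c x * (g x * walks b x))"
    unfolding walks_def by (subst nbr_sum_funpow_adjoint) simp
  finally show ?thesis .
qed

end

section \<open>Walks on a path\<close>

lemma finite_graph_path: "finite_graph {..<n} (parcs (path_graph n))"
  by unfold_locales (auto simp: sym_def)

locale path_walks =
  fixes n :: nat
  assumes n_ge_2: "n \<ge> 2"
begin

sublocale finite_graph "{..<n}" "parcs (path_graph n)"
  by (rule finite_graph_path)

lemma nbrs_first: "parcs (path_graph n) `` {0} = {1}"
  and nbrs_last: "parcs (path_graph n) `` {n - 1} = {n - 2}"
  and nbrs_inner: "0 < x \<Longrightarrow> x < n - 1 \<Longrightarrow> parcs (path_graph n) `` {x} = {x - 1, x + 1}"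
  using n_ge_2 by auto

lemma deg_path: "x < n \<Longrightarrow> deg x = (if x = 0 \<or> x = n - 1 then 1 else 2)"
  using nbrs_first nbrs_last nbrs_inner[of x] by (auto simp: deg_def)

lemma walks_first: "walks (Suc k) 0 = walks k 1"
  and walks_last: "walks (Suc k) (n - 1) = walks k (n - 2)"
  and walks_inner: "0 < x \<Longrightarrow> x < n - 1 \<Longrightarrow> walks (Suc k) x = walks k (x - 1) + walks k (x + 1)"
  by (simp_all only: walks_Suc nbrs_first nbrs_last nbrs_inner) auto

lemma walks_reflect: "x < n \<Longrightarrow> walks k (n - Suc x) = walks k x"
proof (induction k arbitrary: x)
  case (Suc k)
  consider "x = 0" | "x = n - 1" | "0 < x" "x < n - 1" using Suc.prems by linarith
  then show ?case
  proof cases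
    case 1
    then show ?thesis using walks_first[of k] walks_last[of k] Suc.IH[of 1] n_ge_2
      by (simp add: numeral_2_eq_2)
  next
    case 2
    then show ?thesis using walks_first[of k] walks_last[of k] Suc.IH[of 1] n_ge_2
      by (simp add: numeral_2_eq_2)
  next
    case 3
    have "walks (Suc k) (n - Suc x) = walks k (n - Suc x - 1) + walks k (n - Suc x + 1)"
      using 3 by (intro walks_inner) auto
    moreover have "n - Suc x - 1 = n - Suc (x + 1)" "n - Suc x + 1 = n - Suc (x - 1)" using 3 by auto
    ultimately show ?thesis using Suc.IH[of "x + 1"] Suc.IH[of "x - 1"] walks_inner[OF 3, of k] 3 by simp
  qed
qed simp

lemma walks_Suc_le: "x < n \<Longrightarrow> walks (Suc k) x \<le> 2 * walks k x"
proof (induction k arbitrary: x)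
  case 0
  then show ?case by (simp add: walks_1 deg_path)
next
  case (Suc k)
  have "walks (Suc (Suc k)) x = (\<Sum>y\<in>parcs (path_graph n) `` {x}. walks (Suc k) y)" by (rule walks_Suc)
  also have "\<dots> \<le> (\<Sum>y\<in>parcs (path_graph n) `` {x}. 2 * walks k y)"
    by (intro sum_mono Suc.IH) auto
  also have "\<dots> = 2 * walks (Suc k) x" by (simp add: walks_Suc sum_distrib_left)
  finally show ?case .
qed

lemma walks_le_power: "x < n \<Longrightarrow> walks k x \<le> 2 ^ k"
proof (induction k)
  case (Suc k)
  then show ?case using walks_Suc_le[of x k] by simp
qed simp

text \<open>
  The number of walks increases towards the middle of the path. When \<open>x + 1\<close> is the exact middle,
  \<open>x + 2\<close> lies beyond it and mirrors \<open>x\<close>, so that monotonicity alone does not suffice; there the inequality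
  is that of \<open>walks_Suc_le\<close> at \<open>x\<close>.
\<close>
lemma walks_increasing: "2 * Suc x \<le> n - 1 \<Longrightarrow> walks k x \<le> walks k (Suc x)"
proof (induction k arbitrary: x)
  case (Suc k)
  have r: "walks (Suc k) (Suc x) = walks k x + walks k (x + 2)"
    using walks_inner[of "Suc x" k] Suc.prems by simp
  have "2 * Suc (Suc x) \<le> n - 1 \<or> n - 1 = 2 * x + 2 \<or> n - 1 = 2 * x + 3"
    using Suc.prems by arith
  then consider "2 * Suc (Suc x) \<le> n - 1" | "n - 1 = 2 * x + 2" | "n - 1 = 2 * x + 3"
    by blast
  then have key: "walks (Suc k) x \<le> walks k x + walks k (x + 2)"
  proof cases
    case 1
    have up: "walks k (Suc x) \<le> walks k (x + 2)" using Suc.IH[OF 1] by simp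
    show ?thesis
    proof (cases "x = 0")
      case True
      then show ?thesis using up walks_first[of k] walks_nonneg[of k 0] by simp
    next
      case False
      then show ?thesis using up walks_inner[of x k] Suc.IH[of "x - 1"] Suc.prems by auto
    qed
  next
    case 2
    have "n - Suc x = x + 2" "x < n" using 2 by auto
    then have "walks k (x + 2) = walks k x" using walks_reflect[of x k] by simp
    then show ?thesis using walks_Suc_le[of x k] Suc.prems by simp
  next
    case 3
    have "n - Suc (Suc x) = x + 2" "Suc x < n" using 3 by auto
    then have up: "walks k (x + 2) = walks k (Suc x)" using walks_reflect[of "Suc x" k] by simp
    show ?thesis
    proof (cases "x = 0")
      case True
      then show ?thesis using up walks_first[of k] walks_nonneg[of k 0] by simp
    next
      case False
      then show ?thesis using up walks_inner[of x k] Suc.IH[of "x - 1"] Suc.prems by auto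
    qed
  qed
  then show ?case using r by simp
qed simp

lemma walks_first_le: "x < n \<Longrightarrow> walks k 0 \<le> walks k x"
proof -
  have half: "walks k 0 \<le> walks k x" if "2 * x \<le> n - 1" for x
    using that
  proof (induction x)
    case (Suc x)
    then show ?case using walks_increasing[of x k] by simp
  qed simp
  assume x: "x < n"
  show ?thesis
  proof (cases "2 * x \<le> n - 1")
    case True
    then show ?thesis by (rule half)
  next
    case False
    then show ?thesis using half[of "n - Suc x"] walks_reflect[OF x] by simp
  qed
qed

text \<open>
  The difference \<open>deg x * walks b x - walks (Suc b) x\<close> has sum zero and is nonnegative except at the two ends,
  which is where \<open>walks c\<close> is smallest.
\<close>
lemma sum_walks_shift_le:
  "(\<Sum>x<n. walks (Suc b) x * walks c x) \<le> (\<Sum>x<n. real (deg x) * walks b x * walks c x)"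
proof -
  define e where "e x = real (deg x) * walks b x - walks (Suc b) x" for x
  have "(\<Sum>x<n. real (deg x) * walks b x) = (\<Sum>x<n. walks (Suc b) x)"
    using nbr_sum_adjoint[of "\<lambda>_. 1" "walks b"] by (simp add: nbr_sum_def walks_Suc deg_def)
  then have "(\<Sum>x<n. e x) = 0" by (simp add: e_def sum_subtractf)
  (* Subtracting the end value of walks c from it everywhere changes nothing, as e has sum zero. *)
  then have "(\<Sum>x<n. e x * walks c x) = (\<Sum>x<n. e x * walks c x) - (\<Sum>x<n. e x) * walks c 0"
    by simp
  also have "\<dots> = (\<Sum>x<n. e x * (walks c x - walks c 0))"
    by (simp add: right_diff_distrib sum_subtractf sum_distrib_right)
  also have "\<dots> \<ge> 0"
  proof (rule sum_nonneg)
    fix x assume "x \<in> {..<n}"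
    then have x: "x < n" by simp
    show "0 \<le> e x * (walks c x - walks c 0)"
    proof (cases "x = 0 \<or> x = n - 1")
      case True
      then have "walks c x = walks c 0" using walks_reflect[of 0 c] n_ge_2 by auto
      then show ?thesis by simp
    next
      case False
      then have "e x \<ge> 0" using walks_Suc_le[OF x, of b] deg_path[OF x] by (simp add: e_def)
      then show ?thesis using walks_first_le[OF x, of c] by simp
    qed
  qed
  finally show ?thesis by (simp add: e_def left_diff_distrib sum_subtractf)
qed

end

section \<open>Spiders with a leg of length one\<close>

text \<open>
  The spider with legs of lengths \<open>1\<close>, \<open>b\<close> and \<open>c\<close>: a path on \<open>0, \<dots>, b + c\<close> with a pendant vertex
  \<open>b + c + 1\<close> at the branch vertex \<open>b\<close>.
\<close>
definition spider :: "nat \<Rightarrow> nat \<Rightarrow> (nat \<times> nat) set" where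
  "spider b c = insert (b + c + 1, b) (insert (b, b + c + 1) (parcs (path_graph (b + c + 1))))"

text \<open>
  The pendant vertex contributes the degree of the image of the branch vertex.
\<close>
lemma sum_homs_spider:
  assumes "finite_graph V E"
  shows "real (card (homs {..<b + c + 2} (spider b c) V E)) =
    (\<Sum>x\<in>V. real (finite_graph.deg E x) * finite_graph.walks E b x * finite_graph.walks E c x)"
proof -
  interpret finite_graph V E by fact
  note bs = rooted_tree_basic[OF path_graph_rooted_tree[of "b + c"]]
  have v: "{..<b + c + 2} = insert (b + c + 1) {..<Suc (b + c)}" by auto
  have "real (card (homs {..<b + c + 2} (spider b c) V E)) =
      (\<Sum>f\<in>homs {..<b + c + 2} (spider b c) V E. 1)" by simp
  also have "\<dots> = (\<Sum>f\<in>homs {..<Suc (b + c)} (parcs (path_graph (Suc (b + c)))) V E. real (deg (f b)))"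
    unfolding v spider_def using bs(1,2)
    by (subst sum_homs_leaf) (auto simp: deg_def)
  also have "\<dots> = (\<Sum>x\<in>V. walks b x * (real (deg x) * walks c x))"
    by (rule sum_homs_path)
  finally show ?thesis by (simp add: mult_ac)
qed

locale spider_walks =
  fixes b c :: nat
  assumes b_pos: "1 \<le> b" and b_le_c: "b \<le> c"
begin

sublocale finite_graph "{..<b + c + 2}" "spider b c"
  by unfold_locales (auto simp: spider_def sym_def)

lemma nbrs:
  "spider b c `` {0} = {1}"
  "0 < x \<Longrightarrow> x < b + c \<Longrightarrow> x \<noteq> b \<Longrightarrow> spider b c `` {x} = {x - 1, x + 1}"
  "spider b c `` {b} = {b - 1, b + 1, b + c + 1}"
  "spider b c `` {b + c} = {b + c - 1}"
  "spider b c `` {b + c + 1} = {b}"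
  using b_pos b_le_c by (auto simp: spider_def)

lemma nbrs_centre_distinct: "b - 1 \<noteq> b + 1" "b - 1 \<noteq> b + c + 1" "b + 1 \<noteq> b + c + 1"
  using b_pos b_le_c by auto

lemma deg_spider:
  "deg 0 = 1" "0 < x \<Longrightarrow> x < b + c \<Longrightarrow> x \<noteq> b \<Longrightarrow> deg x = 2" "deg b = 3"
  "deg (b + c) = 1" "deg (b + c + 1) = 1"
  using nbrs(1,4,5) nbrs(2)[of x] nbrs_centre_distinct by (auto simp: deg_def nbrs(3))

lemma walks_step:
  "walks (Suc k) 0 = walks k 1"
  "0 < x \<Longrightarrow> x < b + c \<Longrightarrow> x \<noteq> b \<Longrightarrow> walks (Suc k) x = walks k (x - 1) + walks k (x + 1)"
  "walks (Suc k) b = walks k (b - 1) + walks k (b + 1) + walks k (b + c + 1)"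
  "walks (Suc k) (b + c) = walks k (b + c - 1)"
  "walks (Suc k) (b + c + 1) = walks k b"
  using nbrs(1,4,5) nbrs(2)[of x] nbrs_centre_distinct by (auto simp: walks_Suc nbrs(3))

text \<open>
  As long as a walk cannot pass the end of the long leg, it has on average at least two continuations.
  At the branch vertex, the pendant vertex and the neighbour on the short leg each have at least one
  continuation, back to the branch vertex, so that together they make up for one vertex of degree two.
\<close>
lemma walks_long_leg: "k + t \<le> c \<Longrightarrow> 2 ^ k \<le> walks k (b + t)"
proof (induction k arbitrary: t rule: less_induct)
  case (less k)
  show ?case
  proof (cases k)
    case 0
    then show ?thesis by simp
  next
    case (Suc j)
    show ?thesis
    proof (cases "t = 0")
      case True
      show ?thesis
      proof (cases j)
        case 0
        then show ?thesis using True Suc walks_step(3)[of 0] by simp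
      next
        case (Suc i)
        have "2 ^ j \<le> walks j (b + 1)" using less.IH[of j 1] less.prems \<open>k = Suc j\<close> by simp
        moreover have "2 ^ i \<le> walks i b" using less.IH[of i 0] less.prems \<open>k = Suc j\<close> Suc by simp
        moreover have "walks i b \<le> walks j (b - 1)"
        proof -
          have "b \<in> spider b c `` {b - 1}" using b_pos by (auto simp: spider_def)
          then show ?thesis unfolding Suc walks_Suc by (intro member_le_sum) (auto simp: walks_nonneg)
        qed
        moreover have "walks j (b + c + 1) = walks i b" unfolding Suc by (rule walks_step)
        ultimately show ?thesis using \<open>k = Suc j\<close> Suc True walks_step(3)[of j] by simp
      qed
    next
      case False
      have "walks k (b + t) = walks j (b + t - 1) + walks j (b + t + 1)"
        unfolding Suc using False less.prems Suc b_pos by (intro walks_step) auto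
      moreover have "2 ^ j \<le> walks j (b + (t - 1))" using less.IH[of j "t - 1"] less.prems Suc False by simp
      moreover have "2 ^ j \<le> walks j (b + (t + 1))" using less.IH[of j "t + 1"] less.prems Suc by simp
      ultimately show ?thesis using Suc False by simp
    qed
  qed
qed

lemma walks_centre: "k \<le> c \<Longrightarrow> 2 ^ k \<le> walks k b"
  using walks_long_leg[of k 0] by simp

text \<open>
  A walk of at most \<open>x\<close> steps from \<open>x\<close> does not pass the end of the short leg, and \<open>walks_centre\<close> takes
  over once it reaches the branch vertex.
\<close>
lemma walks_short_leg: "k \<le> c \<Longrightarrow> x \<le> b \<Longrightarrow> k \<le> x \<Longrightarrow> 2 ^ k \<le> walks k x"
proof (induction k arbitrary: x)
  case (Suc k)
  show ?case
  proof (cases "x = b")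
    case True
    then show ?thesis using walks_centre[of "Suc k"] Suc.prems by simp
  next
    case False
    then have "walks (Suc k) x = walks k (x - 1) + walks k (x + 1)"
      using Suc.prems b_pos by (intro walks_step) auto
    moreover have "2 ^ k \<le> walks k (x - 1)" "2 ^ k \<le> walks k (x + 1)"
      using Suc.prems False by (auto intro!: Suc.IH)
    ultimately show ?thesis by simp
  qed
qed simp

text \<open>
  The neighbours on the two legs contribute at least \<open>2^(b - 1)\<close> each, and the pendant vertex at least half
  as much.
\<close>
lemma walks_centre_ge: "5 * 2 ^ b \<le> 4 * walks b b"
proof -
  obtain a where a: "b = Suc a" using b_pos by (cases b) auto
  have "walks b b = walks a (b - 1) + walks a (b + 1) + walks a (b + c + 1)"
    using walks_step(3)[of a] a by simp
  moreover have "2 ^ a \<le> walks a (b - 1)" using walks_short_leg[of a "b - 1"] a b_le_c by simp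
  moreover have "2 ^ a \<le> walks a (b + 1)" using walks_long_leg[of a 1] a b_le_c by simp
  moreover have "2 ^ a \<le> 2 * walks a (b + c + 1)"
  proof (cases a)
    case (Suc i)
    then show ?thesis using walks_step(5)[of i] walks_centre[of i] a b_le_c by simp
  qed simp
  ultimately show ?thesis using a by simp
qed

interpretation P: path_walks "b + c + 2" by unfold_locales simp

text \<open>
  The short leg together with the branch vertex is identified with the first \<open>b + 1\<close> vertices of the path.
  Up to the branch vertex both walk counts obey the same recursion, and at the branch vertex the spider
  reaches the maximum \<open>2^k\<close> possible on a path.
\<close>
lemma path_walks_le_left: "k \<le> c \<Longrightarrow> x \<le> b \<Longrightarrow> P.walks k x \<le> walks k x"
proof (induction k arbitrary: x)
  case (Suc k)
  consider "x = b" | "x < b" "x = 0" | "x < b" "0 < x" using Suc.prems by linarith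
  then show ?case
  proof cases
    case 1
    then show ?thesis using walks_centre[of "Suc k"] P.walks_le_power[of b "Suc k"] Suc.prems by simp
  next
    case 2
    then show ?thesis using Suc.IH[of 1] Suc.prems walks_step(1) P.walks_first by simp
  next
    case 3
    have "P.walks (Suc k) x = P.walks k (x - 1) + P.walks k (x + 1)"
      using 3 b_le_c by (intro P.walks_inner) auto
    also have "\<dots> \<le> walks k (x - 1) + walks k (x + 1)"
      using 3 Suc.prems by (intro add_mono Suc.IH) auto
    also have "\<dots> = walks (Suc k) x" using 3 by (intro walks_step(2)[symmetric]) auto
    finally show ?thesis .
  qed
qed (simp only: P.walks_0 walks_0 order_refl)

text \<open>
  The same comparison for the long leg, which is aligned with the other end of the path. The branch vertex
  corresponds here to the path vertex \<open>b + 1\<close>.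
\<close>
lemma path_walks_le_right: "k \<le> c \<Longrightarrow> t \<le> c \<Longrightarrow> P.walks k (b + 1 + t) \<le> walks k (b + t)"
proof (induction k arbitrary: t)
  case (Suc k)
  consider "t = 0" | "t = c" "0 < t" | "t < c" "0 < t" using Suc.prems by linarith
  then show ?case
  proof cases
    case 1
    then show ?thesis using walks_centre[of "Suc k"] P.walks_le_power[of "b + 1" "Suc k"] Suc.prems b_le_c b_pos by simp
  next
    case 2
    then show ?thesis
      using Suc.IH[of "c - 1"] Suc.prems walks_step(4)[of k] P.walks_last[of k] by simp
  next
    case 3
    have "P.walks (Suc k) (b + 1 + t) = P.walks k (b + 1 + t - 1) + P.walks k (b + 1 + t + 1)"
      using 3 by (intro P.walks_inner) auto
    also have "\<dots> = P.walks k (b + 1 + (t - 1)) + P.walks k (b + 1 + (t + 1))"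
      using 3 by simp
    also have "\<dots> \<le> walks k (b + (t - 1)) + walks k (b + (t + 1))"
      using 3 Suc.prems by (intro add_mono Suc.IH) auto
    also have "\<dots> = walks k (b + t - 1) + walks k (b + t + 1)" using 3 by simp
    also have "\<dots> = walks (Suc k) (b + t)" using 3 by (intro walks_step(2)[symmetric]) auto
    finally show ?thesis .
  qed
qed (simp only: P.walks_0 walks_0 order_refl)

lemma split_sum_at:
  fixes F :: "nat \<Rightarrow> real"
  shows "(\<Sum>x<b + c + 2. F x) = (\<Sum>x<b. F x) + F b + (\<Sum>t<c. F (b + 1 + t)) + F (b + c + 1)"
proof -
  have "(\<Sum>x<b + c + 2. F x) = (\<Sum>x<Suc b + c. F x) + F (b + c + 1)" by simp
  also have "(\<Sum>x<Suc b + c. F x) = (\<Sum>x<Suc b. F x) + (\<Sum>t<c. F (Suc b + t))"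
    by (induction c) auto
  finally show ?thesis by simp
qed

text \<open>
  The legs of the spider dominate the two ends of the path vertex by vertex. What is left are the branch
  vertex and the pendant vertex of the spider, against the two middle vertices of the path. On the path
  each of these contributes at most \<open>2 \<cdot> 2^b \<cdot> 2^c\<close>. On the spider the branch vertex contributes at least
  \<open>3 \<cdot> (5/4) 2^b \<cdot> 2^c\<close> and the pendant vertex at least \<open>(1/2) 2^b \<cdot> (1/2) 2^c\<close>, which add up to
  \<open>4 \<cdot> 2^(b + c)\<close> as well.
\<close>
lemma card_End_path_le_spider:
  "real (card (End (path_graph (b + c + 2)))) \<le> real (card (homs {..<b + c + 2} (spider b c) {..<b + c + 2} (spider b c)))"
proof -
  let ?n = "b + c + 2"
  define F where "F x = real (P.deg x) * P.walks b x * P.walks c x" for x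
  define G where "G x = real (deg x) * walks b x * walks c x" for x
  have "real (card (End (path_graph ?n))) = (\<Sum>x<?n. P.walks (Suc b) x * P.walks c x)"
    using P.sum_homs_path[where g = "\<lambda>_. 1" and c = "Suc b" and b = c] by (simp add: End_eq_homs)
  also have "\<dots> \<le> (\<Sum>x<?n. F x)" unfolding F_def by (rule P.sum_walks_shift_le)
  also have "(\<Sum>x<?n. F x) = (\<Sum>x<b. F x) + F b + (F (b + 1) + (\<Sum>t<c. F (b + 2 + t)))"
  proof -
    have "(\<Sum>t<c. F (b + 1 + t)) + F (b + c + 1) = (\<Sum>t<Suc c. F (b + 1 + t))" by simp
    also have "\<dots> = F (b + 1) + (\<Sum>t<c. F (b + 2 + t))" by (subst sum.lessThan_Suc_shift) simp
    finally show ?thesis unfolding split_sum_at[of F] by simp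
  qed
  also have "\<dots> \<le> (\<Sum>x<b. G x) + (\<Sum>t<c. G (b + 1 + t)) + 4 * 2 ^ (b + c)"
  proof -
    have left: "F x \<le> G x" if "x < b" for x
    proof -
      have "P.deg x = deg x"
        using that deg_spider(1) deg_spider(2)[of x] P.deg_path[of x] by (cases "x = 0") simp_all
      moreover have "P.walks b x \<le> walks b x" "P.walks c x \<le> walks c x"
        using that b_le_c by (intro path_walks_le_left; simp)+
      ultimately show ?thesis unfolding F_def G_def
        by (intro mult_mono mult_nonneg_nonneg P.walks_nonneg walks_nonneg) simp_all
    qed
    have right: "F (b + 2 + t) \<le> G (b + 1 + t)" if "t < c" for t
    proof -
      have "P.deg (b + 2 + t) = deg (b + 1 + t)"
      proof (cases "Suc t = c")
        case True
        then have e: "b + 1 + t = b + c" by simp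
        show ?thesis unfolding e using deg_spider(4) P.deg_path[of "b + 2 + t"] True by simp
      next
        case False
        then show ?thesis using deg_spider(2)[of "b + 1 + t"] P.deg_path[of "b + 2 + t"] that by simp
      qed
      moreover have "P.walks b (b + 2 + t) \<le> walks b (b + 1 + t)" "P.walks c (b + 2 + t) \<le> walks c (b + 1 + t)"
        using path_walks_le_right[of b "Suc t"] path_walks_le_right[of c "Suc t"] that b_le_c by simp_all
      ultimately show ?thesis unfolding F_def G_def
        by (intro mult_mono mult_nonneg_nonneg P.walks_nonneg walks_nonneg) simp_all
    qed
    have mid: "F x \<le> 2 * 2 ^ (b + c)" if "x = b \<or> x = b + 1" for x
    proof -
      have "P.deg x = 2" using that b_pos b_le_c P.deg_path[of x] by auto
      moreover have "P.walks b x * P.walks c x \<le> 2 ^ b * 2 ^ c"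
        using that b_pos b_le_c by (intro mult_mono P.walks_le_power P.walks_nonneg) auto
      ultimately show ?thesis by (simp add: F_def power_add)
    qed
    have "(\<Sum>x<b. F x) \<le> (\<Sum>x<b. G x)" by (intro sum_mono left) simp
    moreover have "(\<Sum>t<c. F (b + 2 + t)) \<le> (\<Sum>t<c. G (b + 1 + t))" by (intro sum_mono right) simp
    ultimately show ?thesis using mid[of b] mid[of "b + 1"] by simp
  qed
  also have "\<dots> \<le> (\<Sum>x<b. G x) + (\<Sum>t<c. G (b + 1 + t)) + (G b + G (b + c + 1))"
  proof -
    have "5 * 2 ^ b * 2 ^ c \<le> 4 * walks b b * walks c b"
      by (rule mult_mono[OF walks_centre_ge walks_centre[of c]]) (simp_all add: walks_nonneg)
    moreover have half: "2 ^ k \<le> 2 * walks k (b + c + 1)" if k: "1 \<le> k" "k \<le> c" for k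
    proof -
      obtain i where "k = Suc i" using k by (cases k) auto
      then show ?thesis using walks_step(5)[of i] walks_centre[of i] k by simp
    qed
    have "2 ^ b * 2 ^ c \<le> (2 * walks b (b + c + 1)) * (2 * walks c (b + c + 1))"
      using b_pos b_le_c by (intro mult_mono half) (auto simp: walks_nonneg)
    ultimately show ?thesis
      using deg_spider(3,5) by (simp add: G_def power_add)
  qed
  also have "\<dots> = (\<Sum>x<?n. G x)" unfolding split_sum_at[of G] by simp
  also have "\<dots> = real (card (homs {..<?n} (spider b c) {..<?n} (spider b c)))"
    unfolding G_def by (rule sum_homs_spider[OF finite_graph_axioms, symmetric])
  finally show ?thesis .
qed

end

section \<open>The entropy bound\<close>

text \<open>
  The Gibbs variational inequality, that is, Jensen's inequality for the exponential function at the
  points \<open>a i - ln (p i)\<close> with weights \<open>p i\<close>; it is proved by the tangent at their mean.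
\<close>
lemma exp_entropy_le_sum_exp:
  fixes p a :: "'i \<Rightarrow> real"
  assumes "finite I" "\<And>i. i \<in> I \<Longrightarrow> p i > 0" "(\<Sum>i\<in>I. p i) = 1"
  shows "exp (\<Sum>i\<in>I. p i * (a i - ln (p i))) \<le> (\<Sum>i\<in>I. exp (a i))"
proof -
  define t where "t i = a i - ln (p i)" for i
  define m where "m = (\<Sum>i\<in>I. p i * t i)"
  have "exp m = (\<Sum>i\<in>I. p i * (exp m * (1 + (t i - m))))"
  proof -
    have "(\<Sum>i\<in>I. p i * (exp m * (1 + (t i - m))))
        = exp m * ((\<Sum>i\<in>I. p i) + ((\<Sum>i\<in>I. p i * t i) - (\<Sum>i\<in>I. p i) * m))"
      by (simp add: sum_distrib_left sum_distrib_right sum.distrib[symmetric] sum_subtractf[symmetric] algebra_simps)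
    then show ?thesis using assms(3) by (simp add: m_def)
  qed
  also have "\<dots> \<le> (\<Sum>i\<in>I. exp (a i))"
  proof (rule sum_mono)
    fix i assume i: "i \<in> I"
    have "exp m * (1 + (t i - m)) \<le> exp m * exp (t i - m)"
      using exp_ge_add_one_self[of "t i - m"] by (intro mult_left_mono) auto
    also have "\<dots> = exp (t i)" by (simp add: exp_add[symmetric])
    finally have "p i * (exp m * (1 + (t i - m))) \<le> p i * exp (t i)"
      using assms(2)[OF i] by (intro mult_left_mono) auto
    also have "\<dots> = exp (a i)" using assms(2)[OF i] by (simp add: t_def exp_diff)
    finally show "p i * (exp m * (1 + (t i - m))) \<le> exp (a i)" .
  qed
  finally show ?thesis by (simp add: m_def t_def)
qed

locale stationary_chain = finite_graph V E for V :: "'b set" and E +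
  fixes \<pi> :: "'b \<Rightarrow> real" and P :: "'b \<Rightarrow> 'b \<Rightarrow> real"
  assumes \<pi>_pos: "x \<in> V \<Longrightarrow> \<pi> x > 0" and \<pi>_sum: "(\<Sum>x\<in>V. \<pi> x) = 1"
    and P_pos: "(x, y) \<in> E \<Longrightarrow> P x y > 0"
    and P_sum: "x \<in> V \<Longrightarrow> (\<Sum>y\<in>E `` {x}. P x y) = 1"
    and stationary: "y \<in> V \<Longrightarrow> (\<Sum>x\<in>E `` {y}. \<pi> x * P x y) = \<pi> y"
begin

definition entropy :: real where
  "entropy = - (\<Sum>x\<in>V. \<pi> x * ln (\<pi> x))"

definition entropy_rate :: real where
  "entropy_rate = - (\<Sum>x\<in>V. \<pi> x * (\<Sum>y\<in>E `` {x}. P x y * ln (P x y)))"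

text \<open>
  The arbitrary weights \<open>g\<close> make the induction work. For a new leaf \<open>u\<close> at \<open>p\<close>, the Gibbs inequality for
  the distribution of one step bounds the sum over the images of \<open>u\<close> by \<open>exp (k (f p))\<close>, which is absorbed
  into the weight of \<open>p\<close>. By stationarity, \<open>k\<close> has the same mean as the weight of \<open>u\<close>, up to the entropy
  rate.
\<close>
lemma exp_entropy_le_sum_homs:
  assumes "rooted_tree r S D"
  shows "exp ((\<Sum>v\<in>S. \<Sum>x\<in>V. \<pi> x * g v x) + entropy + (real (card S) - 1) * entropy_rate)
    \<le> (\<Sum>f\<in>homs S D V E. exp (\<Sum>v\<in>S. g v (f v)))"
  using assms
proof (induction arbitrary: g)
  case root
  have "exp (\<Sum>x\<in>V. \<pi> x * (g r x - ln (\<pi> x))) \<le> (\<Sum>x\<in>V. exp (g r x))"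
    by (intro exp_entropy_le_sum_exp finite_V \<pi>_pos \<pi>_sum)
  moreover have "(\<Sum>x\<in>V. \<pi> x * (g r x - ln (\<pi> x))) = (\<Sum>x\<in>V. \<pi> x * g r x) + entropy"
    by (simp add: entropy_def right_diff_distrib sum_subtractf)
  ultimately show ?case using sum_homs_root[where r = r and F = "\<lambda>x. exp (g r x)"] by simp
next
  case (leaf S D p u)
  note b = rooted_tree_basic[OF leaf.hyps(1)]
  define k where "k x = (\<Sum>y\<in>E `` {x}. P x y * (g u y - ln (P x y)))" for x
  define g' where "g' = g(p := \<lambda>x. g p x + k x)"
  have g'_sum: "(\<Sum>v\<in>S. \<phi> v (g' v)) = (\<Sum>v\<in>S. \<phi> v (g v)) + \<psi>"
    if "\<phi> p (g' p) = \<phi> p (g p) + \<psi>" for \<phi> :: "'a \<Rightarrow> ('b \<Rightarrow> real) \<Rightarrow> real" and \<psi>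
  proof -
    have "(\<Sum>v\<in>S. \<phi> v (g' v)) = \<phi> p (g' p) + (\<Sum>v\<in>S - {p}. \<phi> v (g' v))"
      using b(1) leaf.hyps(2) by (rule sum.remove)
    moreover have "(\<Sum>v\<in>S. \<phi> v (g v)) = \<phi> p (g p) + (\<Sum>v\<in>S - {p}. \<phi> v (g v))"
      using b(1) leaf.hyps(2) by (rule sum.remove)
    moreover have "(\<Sum>v\<in>S - {p}. \<phi> v (g' v)) = (\<Sum>v\<in>S - {p}. \<phi> v (g v))"
      by (rule sum.cong) (auto simp: g'_def)
    ultimately show ?thesis using that by simp
  qed
  have mean_k: "(\<Sum>x\<in>V. \<pi> x * k x) = (\<Sum>x\<in>V. \<pi> x * g u x) + entropy_rate"
  proof -
    have "(\<Sum>x\<in>V. \<pi> x * k x) = (\<Sum>x\<in>V. \<Sum>y\<in>E `` {x}. \<pi> x * P x y * g u y) + entropy_rate"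
      by (simp add: k_def entropy_rate_def right_diff_distrib sum_subtractf sum_distrib_left mult.assoc)
    also have "(\<Sum>x\<in>V. \<Sum>y\<in>E `` {x}. \<pi> x * P x y * g u y) = (\<Sum>y\<in>V. \<Sum>x\<in>E `` {y}. \<pi> x * P x y * g u y)"
      by (rule sum_swap_nbrs)
    also have "\<dots> = (\<Sum>y\<in>V. \<pi> y * g u y)"
      by (intro sum.cong refl) (simp add: sum_distrib_right[symmetric] stationary)
    finally show ?thesis .
  qed
  have "(\<Sum>v\<in>insert u S. \<Sum>x\<in>V. \<pi> x * g v x) + entropy + (real (card (insert u S)) - 1) * entropy_rate
      = (\<Sum>v\<in>S. \<Sum>x\<in>V. \<pi> x * g' v x) + entropy + (real (card S) - 1) * entropy_rate"
  proof -
    have "(\<Sum>v\<in>S. \<Sum>x\<in>V. \<pi> x * g' v x) = (\<Sum>v\<in>S. \<Sum>x\<in>V. \<pi> x * g v x) + (\<Sum>x\<in>V. \<pi> x * k x)"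
      by (rule g'_sum[of "\<lambda>v h. \<Sum>x\<in>V. \<pi> x * h x"]) (simp add: g'_def distrib_left sum.distrib)
    then show ?thesis using b(1) leaf.hyps(3) mean_k by (simp add: algebra_simps)
  qed
  then have "exp ((\<Sum>v\<in>insert u S. \<Sum>x\<in>V. \<pi> x * g v x) + entropy + (real (card (insert u S)) - 1) * entropy_rate)
      \<le> (\<Sum>f\<in>homs S D V E. exp (\<Sum>v\<in>S. g' v (f v)))"
    using leaf.IH[of g'] by (simp only:)
  also have "\<dots> \<le> (\<Sum>f\<in>homs S D V E. \<Sum>y\<in>E `` {f p}. exp (\<Sum>v\<in>insert u S. g v ((f(u := y)) v)))"
  proof (rule sum_mono)
    fix f assume "f \<in> homs S D V E"
    then have fp: "f p \<in> V" using leaf.hyps(2) by (simp add: mem_homs_iff)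
    have ext: "(\<Sum>v\<in>insert u S. g v ((f(u := y)) v)) = (\<Sum>v\<in>S. g v (f v)) + g u y" for y
    proof -
      have "(\<Sum>v\<in>S. g v ((f(u := y)) v)) = (\<Sum>v\<in>S. g v (f v))"
        using leaf.hyps(3) by (intro sum.cong) auto
      then show ?thesis using b(1) leaf.hyps(3) by simp
    qed
    have "(\<Sum>v\<in>S. g' v (f v)) = (\<Sum>v\<in>S. g v (f v)) + k (f p)"
      by (rule g'_sum[of "\<lambda>v h. h (f v)"]) (simp add: g'_def)
    then have "exp (\<Sum>v\<in>S. g' v (f v)) = exp (\<Sum>v\<in>S. g v (f v)) * exp (k (f p))"
      by (simp add: exp_add)
    also have "\<dots> \<le> exp (\<Sum>v\<in>S. g v (f v)) * (\<Sum>y\<in>E `` {f p}. exp (g u y))"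
      unfolding k_def by (intro mult_left_mono exp_entropy_le_sum_exp finite_nbrs P_sum[OF fp]) (auto intro: P_pos)
    also have "\<dots> = (\<Sum>y\<in>E `` {f p}. exp (\<Sum>v\<in>insert u S. g v ((f(u := y)) v)))"
      unfolding ext by (simp add: exp_add sum_distrib_left)
    finally show "exp (\<Sum>v\<in>S. g' v (f v)) \<le> (\<Sum>y\<in>E `` {f p}. exp (\<Sum>v\<in>insert u S. g v ((f(u := y)) v)))" .
  qed
  also have "\<dots> = (\<Sum>f\<in>homs (insert u S) (insert (u, p) (insert (p, u) D)) V E. exp (\<Sum>v\<in>insert u S. g v (f v)))"
    by (rule sum_homs_leaf[OF b(1,2) leaf.hyps(2,3), symmetric])
  finally show ?case .
qed

corollary exp_entropy_le_card_homs:
  assumes "rooted_tree r S D"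
  shows "exp (entropy + (real (card S) - 1) * entropy_rate) \<le> real (card (homs S D V E))"
  using exp_entropy_le_sum_homs[OF assms, of "\<lambda>_ _. 0"] by simp

end

text \<open>
  The entropy bound for the random walk on a graph with edge weights \<open>w\<close>, whose stationary distribution is
  \<open>d x / Z\<close>. With \<open>A = \<Sum> d ln d\<close> and \<open>B = \<Sum> w ln w\<close>, its entropy is \<open>ln Z - A / Z\<close> and its entropy rate is
  \<open>(A - B) / Z\<close>.
\<close>
lemma (in finite_graph) weighted_walk_card_homs:
  fixes w :: "'b \<Rightarrow> 'b \<Rightarrow> real"
  assumes "rooted_tree r S D" "V \<noteq> {}" "\<And>x. x \<in> V \<Longrightarrow> E `` {x} \<noteq> {}"
    and w_pos: "\<And>x y. (x, y) \<in> E \<Longrightarrow> w x y > 0" and w_sym: "\<And>x y. w x y = w y x"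
  defines "d \<equiv> \<lambda>x. \<Sum>y\<in>E `` {x}. w x y"
  defines "Z \<equiv> \<Sum>x\<in>V. d x"
  shows "Z * exp (((real (card S) - 2) * (\<Sum>x\<in>V. d x * ln (d x))
      - (real (card S) - 1) * (\<Sum>x\<in>V. \<Sum>y\<in>E `` {x}. w x y * ln (w x y))) / Z)
    \<le> real (card (homs S D V E))"
proof -
  have d_pos: "d x > 0" if "x \<in> V" for x
    unfolding d_def using assms(3)[OF that] by (intro sum_pos finite_nbrs) (auto intro: w_pos)
  have Z_pos: "Z > 0" unfolding Z_def using assms(2) by (intro sum_pos finite_V d_pos)
  have V: "x \<in> V" "y \<in> V" if "(x, y) \<in> E" for x y using that arcs_in by auto
  interpret stationary_chain V E "\<lambda>x. d x / Z" "\<lambda>x y. w x y / d x"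
  proof unfold_locales
    fix y assume y: "y \<in> V"
    have "(\<Sum>x\<in>E `` {y}. d x / Z * (w x y / d x)) = (\<Sum>x\<in>E `` {y}. w y x / Z)"
    proof (rule sum.cong)
      fix x assume "x \<in> E `` {y}"
      then have "d x \<noteq> 0" using d_pos[of x] V by force
      then show "d x / Z * (w x y / d x) = w y x / Z" using w_sym[of x y] by simp
    qed simp
    then show "(\<Sum>x\<in>E `` {y}. d x / Z * (w x y / d x)) = d y / Z"
      by (simp add: d_def sum_divide_distrib)
  next
    fix x assume "x \<in> V"
    then have "d x \<noteq> 0" using d_pos[of x] by simp
    then show "(\<Sum>y\<in>E `` {x}. w x y / d x) = 1"
      by (simp add: sum_divide_distrib[symmetric]) (simp add: d_def)
  next
    show "(\<Sum>x\<in>V. d x / Z) = 1" using Z_pos by (simp add: sum_divide_distrib[symmetric]) (simp add: Z_def)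
  qed (use d_pos Z_pos w_pos V in auto)
  define A where "A = (\<Sum>x\<in>V. d x * ln (d x))"
  define B where "B = (\<Sum>x\<in>V. \<Sum>y\<in>E `` {x}. w x y * ln (w x y))"
  have "(\<Sum>x\<in>V. d x / Z * ln (d x / Z)) = (\<Sum>x\<in>V. d x * ln (d x) / Z - d x * (ln Z / Z))"
    using d_pos Z_pos by (intro sum.cong refl) (simp add: ln_div less_imp_neq[symmetric] field_simps)
  also have "\<dots> = A / Z - Z * (ln Z / Z)"
    by (simp only: sum_subtractf sum_divide_distrib[symmetric] sum_distrib_right[symmetric] A_def Z_def)
  finally have ent: "entropy = ln Z - A / Z" using Z_pos by (simp add: entropy_def)
  have "(\<Sum>x\<in>V. d x / Z * (\<Sum>y\<in>E `` {x}. w x y / d x * ln (w x y / d x)))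
      = (\<Sum>x\<in>V. (\<Sum>y\<in>E `` {x}. w x y * ln (w x y)) / Z - d x * ln (d x) / Z)"
  proof (rule sum.cong)
    fix x assume x: "x \<in> V"
    have "d x / Z * (\<Sum>y\<in>E `` {x}. w x y / d x * ln (w x y / d x))
        = (\<Sum>y\<in>E `` {x}. (w x y * ln (w x y) - w x y * ln (d x)) / Z)"
      unfolding sum_distrib_left
    proof (rule sum.cong)
      fix y assume "y \<in> E `` {x}"
      then have "w x y > 0" using w_pos by simp
      then show "d x / Z * (w x y / d x * ln (w x y / d x)) = (w x y * ln (w x y) - w x y * ln (d x)) / Z"
        using d_pos[OF x] Z_pos by (simp add: ln_div right_diff_distrib diff_divide_distrib)
    qed simp
    also have "\<dots> = (\<Sum>y\<in>E `` {x}. w x y * ln (w x y)) / Z - d x * ln (d x) / Z"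
      by (simp add: sum_divide_distrib[symmetric] sum_subtractf sum_distrib_right[symmetric] d_def diff_divide_distrib)
    finally show "d x / Z * (\<Sum>y\<in>E `` {x}. w x y / d x * ln (w x y / d x))
      = (\<Sum>y\<in>E `` {x}. w x y * ln (w x y)) / Z - d x * ln (d x) / Z" .
  qed simp
  also have "\<dots> = B / Z - A / Z"
    by (simp only: sum_subtractf sum_divide_distrib[symmetric] A_def B_def)
  finally have rate: "entropy_rate = A / Z - B / Z" by (simp add: entropy_rate_def)
  have "entropy + (real (card S) - 1) * entropy_rate
      = ln Z + ((real (card S) - 2) * A - (real (card S) - 1) * B) / Z"
    unfolding ent rate using Z_pos by (simp add: field_simps)
  then have "exp (entropy + (real (card S) - 1) * entropy_rate)
      = Z * exp (((real (card S) - 2) * A - (real (card S) - 1) * B) / Z)"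
    using Z_pos by (simp add: exp_add)
  then show ?thesis using exp_entropy_le_card_homs[OF assms(1)] by (simp only: A_def B_def)
qed

section \<open>Trees with weighted leaf edges\<close>

context tree_graph begin

definition leaves :: "'b set" where
  "leaves = {x \<in> V. deg x = 1}"

definition leaf_deg :: "'b \<Rightarrow> nat" where
  "leaf_deg x = card (E `` {x} \<inter> leaves)"

lemma leaves_subset: "leaves \<subseteq> V" and finite_leaves: "finite leaves"
  using finite_V by (auto simp: leaves_def)

lemma leaf_nbrs:
  assumes "x \<in> leaves" "(x, y) \<in> E"
  shows "E `` {x} = {y}"
proof -
  have "card (E `` {x}) = 1" using assms(1) by (simp add: leaves_def deg_def)
  then obtain z where "E `` {x} = {z}" by (auto simp: card_1_singleton_iff)
  then show ?thesis using assms(2) by auto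
qed

lemma leaf_nbr_not_leaf:
  assumes "card V \<ge> 3" "x \<in> leaves" "(x, y) \<in> E"
  shows "y \<notin> leaves"
proof
  assume y: "y \<in> leaves"
  have yx: "(y, x) \<in> E" using assms(3) sym_E by (meson symD)
  have "{x, y} = V"
  proof (rule closed_eq_V)
    show "{x, y} \<subseteq> V" using assms(3) arcs_in by auto
    show "b \<in> {x, y}" if "(a, b) \<in> E" "a \<in> {x, y}" for a b
      using that leaf_nbrs[OF assms(2,3)] leaf_nbrs[OF y yx] by auto
  qed simp
  moreover have "card {x, y} \<le> 2" by (simp add: card_insert_if)
  ultimately show False using assms(1) by simp
qed

text \<open>
  Each leaf is counted at its only neighbour, which is not a leaf itself.
\<close>
lemma sum_leaf_deg:
  assumes "card V \<ge> 3"
  shows "(\<Sum>x\<in>V - leaves. leaf_deg x) = card leaves"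
proof -
  have "real (\<Sum>x\<in>V. leaf_deg x) = (\<Sum>x\<in>V. \<Sum>y\<in>E `` {x}. if y \<in> leaves then 1 else 0)"
    by (simp add: leaf_deg_def sum.If_cases)
  also have "\<dots> = (\<Sum>y\<in>V. \<Sum>x\<in>E `` {y}. if y \<in> leaves then 1 else 0)" by (rule sum_swap_nbrs)
  also have "\<dots> = (\<Sum>y\<in>V. if y \<in> leaves then 1 else 0)"
    by (intro sum.cong refl) (auto simp: leaves_def deg_def)
  also have "\<dots> = real (card leaves)"
    using leaves_subset finite_V by (simp add: sum.If_cases Int_absorb1)
  finally have "(\<Sum>x\<in>V. leaf_deg x) = card leaves" by linarith
  moreover have "(\<Sum>x\<in>V. leaf_deg x) = (\<Sum>x\<in>V - leaves. leaf_deg x)"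
  proof (rule sum.mono_neutral_right)
    show "\<forall>x\<in>V - (V - leaves). leaf_deg x = 0"
    proof
      fix x assume "x \<in> V - (V - leaves)"
      then have "E `` {x} \<inter> leaves = {}" using leaf_nbr_not_leaf[OF assms] by auto
      then show "leaf_deg x = 0" by (simp add: leaf_deg_def)
    qed
  qed (use finite_V in auto)
  ultimately show ?thesis by simp
qed

lemma sum_deg_inner: "(\<Sum>x\<in>V - leaves. deg x) + card leaves + 2 = 2 * card V"
proof -
  have "(\<Sum>x\<in>V. deg x) = (\<Sum>x\<in>V - leaves. deg x) + (\<Sum>x\<in>leaves. deg x)"
    by (rule sum.subset_diff[OF leaves_subset finite_V])
  moreover have "(\<Sum>x\<in>leaves. deg x) = card leaves" by (simp add: leaves_def)
  ultimately show ?thesis using sum_deg_tree by simp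
qed

lemma card_inner: "card (V - leaves) + card leaves = card V"
  using leaves_subset finite_V by (metis card_Diff_subset card_mono finite_leaves le_add_diff_inverse2)

lemma deg_inner_ge_2:
  assumes "card V \<ge> 2" "x \<in> V - leaves" shows "deg x \<ge> 2"
  using deg_pos[OF assms(1), of x] assms(2) by (auto simp: leaves_def)

text \<open>
  The weighted random walk in which the edges at leaves have weight \<open>q\<close> and the others weight \<open>1\<close>: a leaf
  has total weight \<open>q\<close>, and a vertex of degree \<open>i + l\<close> with \<open>l\<close> leaves among its neighbours has total
  weight \<open>i + q l\<close>.
\<close>
lemma leaf_weight_card_homs:
  fixes q :: real
  assumes V3: "card V \<ge> 3" and q: "0 < q"
  defines "d \<equiv> \<lambda>x. real (deg x) - (1 - q) * real (leaf_deg x)"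
  defines "Z \<equiv> 2 * real (card V) - 2 - 2 * (1 - q) * real (card leaves)"
  defines "A \<equiv> (\<Sum>x\<in>V - leaves. d x * ln (d x)) + real (card leaves) * q * ln q"
  defines "B \<equiv> 2 * real (card leaves) * q * ln q"
  shows "Z * exp (((real (card V) - 2) * A - (real (card V) - 1) * B) / Z) \<le> real (card (homs V E V E))"
    and "(\<Sum>x\<in>V - leaves. d x) = Z - real (card leaves) * q"
proof -
  define w where "w x y = (if x \<in> leaves \<or> y \<in> leaves then q else 1)" for x y
  define d' where "d' x = (\<Sum>y\<in>E `` {x}. w x y)" for x
  have d'_leaf: "d' x = q" if "x \<in> leaves" for x
    using that by (simp add: d'_def w_def leaves_def deg_def)
  have inner: "(\<Sum>y\<in>E `` {x}. F (w x y)) = real (leaf_deg x) * F q + (real (deg x) - real (leaf_deg x)) * F 1"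
    if "x \<in> V - leaves" for x and F :: "real \<Rightarrow> real"
  proof -
    have "(\<Sum>y\<in>E `` {x}. F (w x y)) = (\<Sum>y\<in>E `` {x}. if y \<in> leaves then F q else F 1)"
      using that by (intro sum.cong) (auto simp: w_def)
    also have "\<dots> = real (card (E `` {x} \<inter> leaves)) * F q + real (card (E `` {x} - leaves)) * F 1"
      by (simp add: sum.If_cases Diff_eq)
    also have "card (E `` {x} - leaves) = deg x - leaf_deg x"
      unfolding deg_def leaf_deg_def by (rule card_Diff_subset_Int) (auto simp: finite_leaves)
    also have "real (deg x - leaf_deg x) = real (deg x) - real (leaf_deg x)"
      unfolding deg_def leaf_deg_def by (intro of_nat_diff card_mono) auto
    finally show ?thesis by (simp add: leaf_deg_def)
  qed
  have d'_inner: "d' x = d x" if "x \<in> V - leaves" for x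
    using inner[OF that, of "\<lambda>t. t"] by (simp add: d'_def d_def algebra_simps)
  have split: "(\<Sum>x\<in>V. F x) = (\<Sum>x\<in>V - leaves. F x) + (\<Sum>x\<in>leaves. F x)" for F :: "'b \<Rightarrow> real"
    by (rule sum.subset_diff[OF leaves_subset finite_V])
  show sum_d: "(\<Sum>x\<in>V - leaves. d x) = Z - real (card leaves) * q"
  proof -
    have "(\<Sum>x\<in>V - leaves. d x) = real (\<Sum>x\<in>V - leaves. deg x) - (1 - q) * real (\<Sum>x\<in>V - leaves. leaf_deg x)"
      by (simp add: d_def sum_subtractf sum_distrib_left)
    also have "\<dots> = (2 * real (card V) - 2 - real (card leaves)) - (1 - q) * real (card leaves)"
      using sum_deg_inner unfolding sum_leaf_deg[OF V3] by linarith
    finally show ?thesis by (simp add: Z_def algebra_simps)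
  qed
  have Z: "(\<Sum>x\<in>V. d' x) = Z"
    unfolding split using sum_d d'_inner d'_leaf by simp
  have A: "(\<Sum>x\<in>V. d' x * ln (d' x)) = A"
    unfolding split A_def using d'_inner d'_leaf by simp
  have B: "(\<Sum>x\<in>V. \<Sum>y\<in>E `` {x}. w x y * ln (w x y)) = B"
  proof -
    have "(\<Sum>x\<in>leaves. \<Sum>y\<in>E `` {x}. w x y * ln (w x y)) = (\<Sum>x\<in>leaves. q * ln q)"
      by (intro sum.cong refl) (simp add: w_def leaves_def deg_def)
    moreover have "(\<Sum>x\<in>V - leaves. \<Sum>y\<in>E `` {x}. w x y * ln (w x y)) = (\<Sum>x\<in>V - leaves. real (leaf_deg x) * (q * ln q))"
      by (intro sum.cong refl) (simp add: inner[where F = "\<lambda>t. t * ln t"])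
    moreover have "\<dots> = real (\<Sum>x\<in>V - leaves. leaf_deg x) * (q * ln q)"
      by (simp add: sum_distrib_right)
    ultimately show ?thesis unfolding split B_def sum_leaf_deg[OF V3] by simp
  qed
  obtain r where r: "r \<in> V" using nonempty by blast
  have "E `` {x} \<noteq> {}" if "x \<in> V" for x
    using deg_pos[of x] that V3 by (auto simp: deg_def)
  then show "Z * exp (((real (card V) - 2) * A - (real (card V) - 1) * B) / Z) \<le> real (card (homs V E V E))"
    using weighted_walk_card_homs[OF grown[OF r] nonempty, of w] q
    by (simp add: w_def[symmetric] d'_def[symmetric] Z A B) (simp add: w_def disj_commute)
qed

lemma inner_nonempty:
  assumes "card V \<ge> 3" shows "V - leaves \<noteq> {}"
proof
  assume e: "V - leaves = {}"
  show False using sum_deg_inner[unfolded e] card_inner[unfolded e] assms by simp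
qed

text \<open>
  For \<open>q = 1/2\<close> the loss at the leaves cancels against that of their edges: the entropy rate is
  \<open>ln 2\<close> plus a positive multiple of \<open>\<Sum> d ln (d / 2)\<close>, summed over the inner vertices. As
  \<open>d ln (d / 2) \<ge> d - 2\<close> and the inner weights \<open>d\<close> exceed \<open>2\<close> by \<open>L / 2 - 2\<close> in total, the rate is at least
  \<open>ln 2\<close> as soon as the number \<open>L\<close> of leaves is at least four. The bound then has the form
  \<open>2^(n - 2) Z exp (R / Z) \<ge> 2^(n - 2) (Z + R)\<close>, and for \<open>L = 4\<close> the sum \<open>Z + R\<close> is
  \<open>2 n - 6 + 4 ln 2 > 2 n - 4\<close>.
\<close>
lemma many_leaves_card_homs:
  assumes L: "card leaves \<ge> 4"
  shows "(real (card V) - 2) * 2 ^ (card V - 1) + 2 \<le> real (card (homs V E V E))"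
proof -
  define n L where "n = real (card V)" and "L = real (card leaves)"
  have V4: "card V \<ge> 4" using L card_inner by linarith
  then have V3: "card V \<ge> 3" by simp
  have "card (V - leaves) > 0" using inner_nonempty[OF V3] finite_V by (simp add: card_gt_0_iff)
  then have nL: "L \<le> n - 1" and V5: "card V \<ge> 5" using card_inner L unfolding n_def L_def by linarith+
  have L4: "L \<ge> 4" and n5: "n \<ge> 5" using L V5 by (simp_all add: L_def n_def)
  define d where "d x = real (deg x) - (1 - 1/2) * real (leaf_deg x)" for x
  define Z where "Z = 2 * n - 2 - L"
  define A where "A = (\<Sum>x\<in>V - leaves. d x * ln (d x)) + L * (1/2) * ln (1/2)"
  define B where "B = 2 * L * (1/2) * ln (1/2)"
  have bound: "Z * exp (((n - 2) * A - (n - 1) * B) / Z) \<le> real (card (homs V E V E))"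
    and sum_d: "(\<Sum>x\<in>V - leaves. d x) = Z - L / 2"
    using leaf_weight_card_homs[OF V3, of "1/2"] unfolding n_def L_def Z_def A_def B_def d_def by simp_all
  have Z_pos: "Z > 0" using nL n5 by (simp add: Z_def)
  have tangent: "d x * ln 2 + (d x - 2) \<le> d x * ln (d x)" if "x \<in> V - leaves" for x
  proof -
    have "leaf_deg x \<le> deg x" unfolding leaf_deg_def deg_def by (intro card_mono) auto
    then have d1: "d x \<ge> 1" using deg_inner_ge_2[OF _ that] V3 by (simp add: d_def)
    have "ln (2 / d x) \<le> 2 / d x - 1" using d1 by (intro ln_le_minus_one) simp
    then have "d x * (ln 2 - ln (d x)) \<le> d x * (2 / d x - 1)"
      using d1 by (intro mult_left_mono) (simp_all add: ln_div)
    then show ?thesis using d1 by (simp add: algebra_simps)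
  qed
  have "(\<Sum>x\<in>V - leaves. d x * ln 2 + (d x - 2)) \<le> (\<Sum>x\<in>V - leaves. d x * ln (d x))"
    by (intro sum_mono tangent)
  moreover have "(\<Sum>x\<in>V - leaves. d x * ln 2 + (d x - 2)) = (Z - L / 2) * ln 2 + (Z - L / 2) - 2 * (n - L)"
    using card_inner by (simp add: sum.distrib sum_subtractf sum_distrib_right[symmetric] sum_d n_def L_def)
  ultimately have A_ge: "(Z - L) * ln 2 + (L / 2 - 2) \<le> A"
    by (simp add: A_def Z_def ln_div algebra_simps)
  have B: "B = - (L * ln 2)" by (simp add: B_def ln_div)
  define R where "R = L * ln 2 + (n - 2) * (L / 2 - 2)"
  have "(n - 2) * ((Z - L) * ln 2 + (L / 2 - 2)) \<le> (n - 2) * A"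
    using A_ge n5 by (intro mult_left_mono) auto
  then have "(n - 2) * ln 2 * Z + R \<le> (n - 2) * A - (n - 1) * B"
    unfolding B R_def by (simp add: algebra_simps)
  then have "((n - 2) * ln 2 * Z + R) / Z \<le> ((n - 2) * A - (n - 1) * B) / Z"
    using Z_pos by (intro divide_right_mono) auto
  then have "(n - 2) * ln 2 + R / Z \<le> ((n - 2) * A - (n - 1) * B) / Z"
    using Z_pos by (simp add: add_divide_distrib)
  then have "Z * exp ((n - 2) * ln 2 + R / Z) \<le> real (card (homs V E V E))"
    using bound Z_pos by (smt (verit) exp_le_cancel_iff mult_left_mono)
  moreover have "exp ((n - 2) * ln 2) = 2 ^ (card V - 2)"
  proof -
    have "n - 2 = real (card V - 2)" using V5 by (simp add: n_def)
    then show ?thesis by (simp add: exp_of_nat_mult)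
  qed
  moreover have "Z + R \<le> Z * exp (R / Z)"
    using mult_left_mono[OF exp_ge_add_one_self[of "R / Z"], of Z] Z_pos by (simp add: distrib_left)
  ultimately have main: "2 ^ (card V - 2) * (Z + R) \<le> real (card (homs V E V E))"
    by (smt (verit) exp_add mult.assoc mult.commute mult_left_mono zero_le_power)
  have "2 * n - 4 + 2 / 3 \<le> Z + R"
  proof -
    have "L * (2 / 3) \<le> L * ln 2" using ln2_ge_two_thirds L4 by (intro mult_left_mono) auto
    moreover have "3 * (L / 2 - 2) \<le> (n - 2) * (L / 2 - 2)" using L4 n5 by (intro mult_right_mono) auto
    moreover have "2 * n - 4 + 2 / 3 \<le> 2 * n - 2 - L + (x + y)"
      if "L * (2 / 3) \<le> x" "3 * (L / 2 - 2) \<le> y" for x y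
      using that L4 by simp
    ultimately show ?thesis unfolding Z_def R_def by blast
  qed
  then have "2 ^ (card V - 2) * (2 * n - 4 + 2 / 3) \<le> 2 ^ (card V - 2) * (Z + R)"
    by (intro mult_left_mono) auto
  moreover have "(2::real) ^ 3 \<le> 2 ^ (card V - 2)" using V5 by (intro power_increasing) auto
  moreover have "(2::real) ^ (card V - 1) = 2 * 2 ^ (card V - 2)"
  proof -
    have "card V - 1 = Suc (card V - 2)" using V5 by simp
    then show ?thesis by simp
  qed
  ultimately show ?thesis using main by (simp add: n_def algebra_simps)
qed

text \<open>
  The degrees of the inner vertices exceed \<open>2\<close> by one in total, so there is exactly one branch vertex.
\<close>
lemma three_leaves_inner:
  assumes V3: "card V \<ge> 3" and L: "card leaves = 3" and z: "z \<in> V" "deg z \<ge> 3"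
  shows "deg z = 3" "\<And>x. x \<in> V - leaves - {z} \<Longrightarrow> deg x = 2" "card (V - leaves - {z}) + 4 = card V"
proof -
  have zI: "z \<in> V - leaves" using z by (simp add: leaves_def)
  have fin: "finite (V - leaves - {z})" using finite_V by simp
  have c: "card (V - leaves) = Suc (card (V - leaves - {z}))"
    using zI finite_V by (metis card_Suc_Diff1 finite_Diff)
  then show cz: "card (V - leaves - {z}) + 4 = card V" using card_inner L by simp
  have s: "(\<Sum>x\<in>V - leaves. deg x) = deg z + (\<Sum>x\<in>V - leaves - {z}. deg x)"
    using zI finite_V by (intro sum.remove) auto
  have ge: "(\<Sum>x\<in>V - leaves - {z}. deg x) \<ge> (\<Sum>x\<in>V - leaves - {z}. 2)"
    using deg_inner_ge_2 V3 by (intro sum_mono) auto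
  show d3: "deg z = 3" using ge s sum_deg_inner L cz z by simp
  show "deg x = 2" if x: "x \<in> V - leaves - {z}" for x
  proof (rule ccontr)
    assume "deg x \<noteq> 2"
    then have "2 < deg x" using deg_inner_ge_2[of x] V3 x by auto
    then have "(\<Sum>x\<in>V - leaves - {z}. 2) < (\<Sum>x\<in>V - leaves - {z}. deg x)"
      using deg_inner_ge_2 V3 x fin by (intro sum_strict_mono_ex1) auto
    then show False using s sum_deg_inner L cz d3 by simp
  qed
qed

text \<open>
  The weight \<open>q = 1/3\<close> is the one at which the walk on a long leg loses least at its end. The loss at each
  of the three ends is then exactly one third of the gain \<open>3 ln (3/2)\<close> at the branch vertex, so the entropy
  rate is \<open>ln 2\<close>. With \<open>Z = 2 n - 6\<close> the bound becomes \<open>2^(n - 2) Z exp (2 ln 3 / Z)\<close>, which is at least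
  \<open>2^(n - 2) (2 n - 6 + 2 ln 3)\<close>; here \<open>2 ln 3 > 2\<close> leaves enough room, since \<open>n \<ge> 7\<close>.
\<close>
lemma three_leaves_card_homs:
  assumes V3: "card V \<ge> 3" and L: "card leaves = 3" and z: "z \<in> V" "deg z \<ge> 3"
    and z_leaf: "leaf_deg z = 0"
  shows "(real (card V) - 2) * 2 ^ (card V - 1) + 2 \<le> real (card (homs V E V E))"
proof -
  note inner = three_leaves_inner[OF V3 L z]
  define I where "I = V - leaves - {z}"
  define n where "n = real (card V)"
  have zI: "z \<in> V - leaves" using z by (simp add: leaves_def)
  have finI: "finite I" using finite_V by (simp add: I_def)
  (* With two leaves as neighbours, x and these leaves would be a whole component without z. *)
  have leaf_deg_le: "leaf_deg x \<le> 1" if x: "x \<in> I" for x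
  proof (rule ccontr)
    assume "\<not> leaf_deg x \<le> 1"
    then have "card (E `` {x}) \<le> card (E `` {x} \<inter> leaves)"
      using inner(2)[of x] x by (simp add: I_def leaf_deg_def deg_def)
    then have "E `` {x} \<inter> leaves = E `` {x}" by (intro card_seteq) auto
    then have sub: "E `` {x} \<subseteq> leaves" by blast
    have "insert x (E `` {x}) = V"
    proof (rule closed_eq_V)
      show "insert x (E `` {x}) \<subseteq> V" using x arcs_in by (auto simp: I_def)
      show "b \<in> insert x (E `` {x})" if "(a, b) \<in> E" "a \<in> insert x (E `` {x})" for a b
      proof (cases "a = x")
        case True
        then show ?thesis using that by simp
      next
        case False
        then have "(x, a) \<in> E" using that by simp
        then have "a \<in> leaves" "(a, x) \<in> E" using sub sym_E by (auto dest: symD)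
        then have "E `` {a} = {x}" by (rule leaf_nbrs)
        then show ?thesis using that(1) by auto
      qed
    qed simp
    then have "z \<in> insert x leaves" using sub z(1) by blast
    then show False using x zI by (simp add: I_def)
  qed
  have sum_I: "(\<Sum>x\<in>I. leaf_deg x) = 3"
  proof -
    have "(\<Sum>x\<in>V - leaves. leaf_deg x) = leaf_deg z + (\<Sum>x\<in>I. leaf_deg x)"
      unfolding I_def using zI finite_V by (intro sum.remove) auto
    then show ?thesis using sum_leaf_deg[OF V3] L z_leaf by simp
  qed
  have card_I: "card I + 4 = card V" using inner(3) by (simp add: I_def)
  have "(\<Sum>x\<in>I. leaf_deg x) \<le> (\<Sum>x\<in>I. 1)" by (intro sum_mono leaf_deg_le)
  then have V7: "card V \<ge> 7" using sum_I card_I by simp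
  define d where "d x = real (deg x) - (1 - 1/3) * real (leaf_deg x)" for x
  define A where "A = (\<Sum>x\<in>V - leaves. d x * ln (d x)) + 3 * (1/3) * ln (1/3)"
  define B where "B = 2 * 3 * (1/3) * ln (1/3 :: real)"
  define Z where "Z = 2 * n - 6"
  have bound: "Z * exp (((n - 2) * A - (n - 1) * B) / Z) \<le> real (card (homs V E V E))"
    using leaf_weight_card_homs(1)[OF V3, of "1/3"] L unfolding n_def Z_def A_def B_def d_def by simp
  have summand: "d x * ln (d x) = 2 * ln 2 - real (leaf_deg x) * (4 / 3 * ln 3 - 2 / 3 * ln 2)" if x: "x \<in> I" for x
  proof -
    have d2: "deg x = 2" using inner(2) x by (simp add: I_def)
    consider "leaf_deg x = 0" | "leaf_deg x = 1" using leaf_deg_le[OF x] by linarith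
    then show ?thesis
    proof cases
      case 1
      then show ?thesis using d2 by (simp add: d_def)
    next
      case 2
      have "ln (4 / 3 :: real) = 2 * ln 2 - ln 3"
        using ln_div[of 4 "3::real"] ln_realpow[of 2 2] by simp
      moreover have "d x = 4 / 3" using 2 d2 by (simp add: d_def)
      ultimately show ?thesis using 2 by (simp only:) (simp add: field_simps)
    qed
  qed
  have "(\<Sum>x\<in>V - leaves. d x * ln (d x)) = d z * ln (d z) + (\<Sum>x\<in>I. d x * ln (d x))"
    unfolding I_def using zI finite_V by (intro sum.remove) auto
  also have "d z = 3" using inner(1) z_leaf by (simp add: d_def)
  also have "(\<Sum>x\<in>I. d x * ln (d x)) = (\<Sum>x\<in>I. 2 * ln 2 - real (leaf_deg x) * (4 / 3 * ln 3 - 2 / 3 * ln 2))"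
    by (intro sum.cong refl summand)
  also have "\<dots> = real (card I) * (2 * ln 2) - real (\<Sum>x\<in>I. leaf_deg x) * (4 / 3 * ln 3 - 2 / 3 * ln 2)"
    by (simp only: sum_subtractf sum_distrib_right[symmetric] sum_constant of_nat_sum)
  also have "\<dots> = (n - 4) * (2 * ln 2) - 3 * (4 / 3 * ln 3 - 2 / 3 * ln 2)"
    using card_I sum_I by (simp add: n_def flip: card_I)
  finally have A: "A = Z * ln 2 - 2 * ln 3"
    by (simp add: A_def Z_def ln_div algebra_simps)
  have B: "B = - 2 * ln 3" by (simp add: B_def ln_div)
  have Z_pos: "Z > 0" using V7 by (simp add: Z_def n_def)
  have "((n - 2) * A - (n - 1) * B) / Z = (n - 2) * ln 2 + 2 * ln 3 / Z"
    unfolding A B using Z_pos by (simp add: field_simps)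
  then have "Z * (exp ((n - 2) * ln 2) * exp (2 * ln 3 / Z)) \<le> real (card (homs V E V E))"
    using bound by (simp add: exp_add)
  moreover have "exp ((n - 2) * ln 2) = 2 ^ (card V - 2)"
  proof -
    have "n - 2 = real (card V - 2)" using V7 by (simp add: n_def)
    then show ?thesis by (simp add: exp_of_nat_mult)
  qed
  ultimately have "2 ^ (card V - 2) * (Z * exp (2 * ln 3 / Z)) \<le> real (card (homs V E V E))"
    by (simp only: mult_ac)
  moreover have "Z + 2 * ln 3 \<le> Z * exp (2 * ln 3 / Z)"
    using mult_left_mono[OF exp_ge_add_one_self[of "2 * ln 3 / Z"], of Z] Z_pos by (simp add: distrib_left)
  then have "2 ^ (card V - 2) * (Z + 2 * ln 3) \<le> 2 ^ (card V - 2) * (Z * exp (2 * ln 3 / Z))"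
    by (intro mult_left_mono) auto
  ultimately have main: "2 ^ (card V - 2) * (Z + 2 * ln 3) \<le> real (card (homs V E V E))"
    by linarith
  (* The comparison 2^19 < 3^12 transfers the bound 2/3 on ln 2 to ln 3. *)
  have "19 / 18 \<le> ln (3::real)"
  proof -
    have "ln ((2::real) ^ 19) \<le> ln (3 ^ 12)" by (subst ln_le_cancel_iff) auto
    moreover have "ln ((2::real) ^ 19) = real 19 * ln 2" "ln ((3::real) ^ 12) = real 12 * ln 3"
      by (rule ln_realpow; simp)+
    ultimately have "real 19 * ln 2 \<le> real 12 * ln (3::real)" by (simp only:)
    then show ?thesis using ln2_ge_two_thirds by simp
  qed
  then have "2 ^ (card V - 2) * (2 * n - 4 + 1 / 9) \<le> 2 ^ (card V - 2) * (Z + 2 * ln 3)"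
    by (intro mult_left_mono) (auto simp: Z_def)
  moreover have "(2::real) ^ 5 \<le> 2 ^ (card V - 2)" using V7 by (intro power_increasing) auto
  moreover have "(2::real) ^ (card V - 1) = 2 * 2 ^ (card V - 2)"
  proof -
    have "card V - 1 = Suc (card V - 2)" using V7 by simp
    then show ?thesis by simp
  qed
  ultimately show ?thesis using main by (simp add: n_def algebra_simps)
qed

end

section \<open>Recognising a spider\<close>

text \<open>
  A leaf other than the root may be skipped in the growth, as nothing is ever attached to it.
\<close>
lemma rooted_tree_delete_leaf:
  assumes "rooted_tree r S E" "l \<in> S" "l \<noteq> r" "E `` {l} = {a}"
  shows "rooted_tree r (S - {l}) (E - {(l, a), (a, l)})"
  using assms
proof induction
  case root
  then show ?case by simp
next
  case (leaf S E p u)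
  note b = rooted_tree_basic[OF leaf.hyps(1)]
  have u_notin: "(u, x) \<notin> E" "(x, u) \<notin> E" for x using b(2) leaf.hyps(3) by auto
  have up: "u \<noteq> p" using leaf.hyps by auto
  show ?case
  proof (cases "l = u")
    case True
    then have "a = p" using leaf.prems(3) u_notin by auto
    then have "insert u S - {l} = S"
      "insert (u, p) (insert (p, u) E) - {(l, a), (a, l)} = E"
      using True leaf.hyps(3) u_notin by auto
    then show ?thesis using leaf.hyps(1) by simp
  next
    case False
    then have lS: "l \<in> S" using leaf.prems by simp
    have "l \<noteq> p"
    proof
      assume lp: "l = p"
      then have "u \<in> {a}" using leaf.prems(3) by auto
      have "x = u" if "(l, x) \<in> E" for x
        using that leaf.prems(3) \<open>u \<in> {a}\<close> by blast
      then have "E `` {l} = {}" using u_notin by blast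
      then have "{l} = S"
        using lS by (intro rooted_tree_connected[OF leaf.hyps(1)]) auto
      then show False using b(4) leaf.prems(2) by auto
    qed
    then have E1: "E `` {l} = {a}" using leaf.prems(3) False by auto
    then have "a \<noteq> u" using u_notin by auto
    have "rooted_tree r (insert u (S - {l})) (insert (u, p) (insert (p, u) (E - {(l, a), (a, l)})))"
      using leaf.IH[OF lS leaf.prems(2) E1] leaf.hyps \<open>l \<noteq> p\<close> by (intro rooted_tree.leaf) auto
    moreover have "insert u (S - {l}) = insert u S - {l}" using False by auto
    moreover have "insert (u, p) (insert (p, u) (E - {(l, a), (a, l)}))
        = insert (u, p) (insert (p, u) E) - {(l, a), (a, l)}"
      using False \<open>l \<noteq> p\<close> by auto
    ultimately show ?thesis by simp
  qed
qed

text \<open>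
  Deleting the leaf next to the branch vertex leaves a tree of maximum degree two, hence a path; the branch
  vertex is not an end of this path, as it keeps degree two.
\<close>
lemma (in tree_graph) spider_enumeration:
  assumes V3: "card V \<ge> 3" and L: "card leaves = 3" and z: "z \<in> V" "deg z \<ge> 3"
    and l: "l \<in> leaves" "(z, l) \<in> E"
  shows "\<exists>b c p. spider_walks b c \<and> b + c + 2 = card V \<and> bij_betw p {..<b + c + 2} V
    \<and> E = (\<lambda>(i, j). (p i, p j)) ` spider b c"
proof -
  note inner = three_leaves_inner[OF V3 L z]
  define E' where "E' = E - {(l, z), (z, l)}"
  have lz: "(l, z) \<in> E" using l(2) sym_E by (meson symD)
  have El: "E `` {l} = {z}" by (rule leaf_nbrs[OF l(1) lz])
  have lV: "l \<in> V" "l \<noteq> z" using l no_loop by (auto simp: leaves_def)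
  have tree': "rooted_tree z (V - {l}) E'"
    unfolding E'_def by (rule rooted_tree_delete_leaf[OF grown[OF z(1)] lV El])
  have E'z: "E' `` {z} = E `` {z} - {l}" using lV by (auto simp: E'_def)
  have deg': "card (E' `` {x}) \<le> 2" if "x \<in> V - {l}" for x
  proof (cases "x = z")
    case True
    then show ?thesis using E'z inner(1) l(2) by (simp add: deg_def)
  next
    case False
    have "card (E' `` {x}) \<le> deg x" unfolding deg_def E'_def by (intro card_mono) auto
    also have "deg x \<le> 2" using inner(2)[of x] that False by (cases "x \<in> leaves") (auto simp: leaves_def)
    finally show ?thesis .
  qed
  obtain m where m: "card V = Suc (Suc m)" using V3 by (metis Suc_le_D numeral_3_eq_3 Suc_le_mono)
  have card': "card (V - {l}) = Suc m" using lV finite_V m by simp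
  obtain p where p: "bij_betw p {..<Suc m} (V - {l})" "E' = (\<lambda>(i, j). (p i, p j)) ` parcs (path_graph (Suc m))"
    using max_deg_two_path[OF tree' deg'] unfolding card' by blast
  obtain i where i: "i < Suc m" "z = p i" using p(1) z(1) lV(2) by (auto simp: bij_betw_def)
  have "\<exists>p i. bij_betw p {..<Suc m} (V - {l}) \<and> E' = (\<lambda>(i, j). (p i, p j)) ` parcs (path_graph (Suc m))
      \<and> i \<le> m - i \<and> i \<le> m \<and> z = p i"
  proof (cases "i \<le> m - i")
    case True
    then show ?thesis using p i by (intro exI[of _ p] exI[of _ i]) auto
  next
    case False
    have "z = p (Suc m - Suc (m - i))" using i by simp
    then show ?thesis using path_enumeration_rev[OF p] False
      by (intro exI[of _ "\<lambda>i. p (Suc m - Suc i)"] exI[of _ "m - i"]) auto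
  qed
  then obtain p b where p: "bij_betw p {..<Suc m} (V - {l})"
      "E' = (\<lambda>(i, j). (p i, p j)) ` parcs (path_graph (Suc m))" "b \<le> m - b" "b \<le> m" "z = p b"
    by blast
  have "b \<ge> 1"
  proof (rule ccontr)
    assume "\<not> b \<ge> 1"
    then have b0: "b = 0" by simp
    have "E' `` {z} \<subseteq> {p 1}"
    proof
      fix y assume "y \<in> E' `` {z}"
      then obtain i j where ij: "(i, j) \<in> parcs (path_graph (Suc m))" "p i = z" "y = p j"
        unfolding p(2) by auto
      have "i = b" using p(1,4,5) ij by (auto simp: bij_betw_def inj_on_def)
      then show "y \<in> {p 1}" using ij b0 by simp
    qed
    then have "card (E' `` {z}) \<le> card {p 1}" by (intro card_mono) auto
    then show False using E'z inner(1) l(2) by (simp add: deg_def)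
  qed
  define c where "c = m - b"
  have bc: "b + c = m" using p(4) by (simp add: c_def)
  define p' where "p' = p(Suc m := l)"
  have "bij_betw p' {..<Suc m} (V - {l})"
    using p(1) unfolding p'_def by (subst bij_betw_cong[of _ _ p]) auto
  then have "bij_betw p' {..<Suc (Suc m)} (insert l (V - {l}))"
    using notIn_Un_bij_betw[of "Suc m" "{..<Suc m}" p' "V - {l}"]
    by (simp add: lessThan_Suc[of "Suc m"] p'_def)
  moreover have "insert l (V - {l}) = V" using lV by auto
  ultimately have bij: "bij_betw p' {..<b + c + 2} V" using bc by simp
  have "E' = (\<lambda>(i, j). (p' i, p' j)) ` parcs (path_graph (Suc m))"
    unfolding p(2) p'_def by (rule image_cong) auto
  moreover have "E = insert (l, z) (insert (z, l) E')" using l(2) lz by (auto simp: E'_def)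
  moreover have "p' (Suc m) = l" "p' b = z" using p(4,5) by (auto simp: p'_def)
  ultimately have "E = (\<lambda>(i, j). (p' i, p' j)) ` spider b c"
    using bc by (simp add: spider_def)
  then show ?thesis
    using bij bc m \<open>b \<ge> 1\<close> p(3) by (intro exI[of _ b] exI[of _ c] exI[of _ p']) (auto simp: spider_walks_def c_def)
qed

section \<open>The lower bound and the theorem\<close>

text \<open>
  The star bound for a path in a path, whose degrees are \<open>1\<close> twice and \<open>2\<close> otherwise.
\<close>
lemma card_End_path_le:
  assumes "n \<ge> 2"
  shows "real (card (End (path_graph n))) \<le> (real n - 2) * 2 ^ (n - 1) + 2"
proof -
  obtain k where n: "n = Suc (Suc k)" using assms by (metis Suc_le_D numeral_2_eq_2 Suc_le_mono)
  interpret path_walks n by unfold_locales fact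
  have tree: "rooted_tree 0 {..<n} (parcs (path_graph n))"
    unfolding n by (rule path_graph_rooted_tree)
  have "real (card (End (path_graph n))) \<le> (\<Sum>x<n. real (deg x) ^ (n - 1))"
    using card_homs_le_sum_deg[OF tree] by (simp add: End_eq_homs)
  also have "\<dots> = real (deg 0) ^ (n - 1) + (\<Sum>i<k. real (deg (Suc i)) ^ (n - 1)) + real (deg (Suc k)) ^ (n - 1)"
    unfolding n by (subst sum.lessThan_Suc, subst sum.lessThan_Suc_shift) simp
  also have "\<dots> = 2 + real k * 2 ^ (n - 1)"
  proof -
    have "deg 0 = 1" "deg (Suc k) = 1" using deg_path[of 0] deg_path[of "Suc k"] n by simp_all
    moreover have "deg (Suc i) = 2" if "i < k" for i using deg_path[of "Suc i"] n that by simp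
    ultimately show ?thesis by simp
  qed
  finally show ?thesis using n by simp
qed

lemma (in tree_graph) card_End_path_le_card_homs:
  "card (End (path_graph (card V))) \<le> card (homs V E V E)"
proof (cases "\<forall>x\<in>V. deg x \<le> 2")
  case True
  obtain r where "r \<in> V" using nonempty by blast
  then obtain p where "bij_betw p {..<card V} V" "E = (\<lambda>(i, j). (p i, p j)) ` parcs (path_graph (card V))"
    using max_deg_two_path[OF grown[OF \<open>r \<in> V\<close>]] True unfolding deg_def by blast
  moreover have "parcs (path_graph (card V)) \<subseteq> {..<card V} \<times> {..<card V}" by auto
  ultimately show ?thesis unfolding End_eq_homs path_graph_simps(1)
    using finite_V by (intro card_homs_le_of_bij)
next
  case False
  then obtain z where z: "z \<in> V" "deg z \<ge> 3" by force
  have V3: "card V \<ge> 3" using deg_le[OF z(1)] z(2) by simp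
  have zI: "z \<in> V - leaves" using z by (simp add: leaves_def)
  have "card leaves \<ge> 3"
  proof -
    have "(\<Sum>x\<in>V - leaves. 2) < (\<Sum>x\<in>V - leaves. deg x)"
      using deg_inner_ge_2 V3 zI z(2) finite_V by (intro sum_strict_mono_ex1) force+
    then show ?thesis using sum_deg_inner card_inner by simp
  qed
  then consider "card leaves \<ge> 4" | "card leaves = 3" "leaf_deg z = 0" | "card leaves = 3" "leaf_deg z \<noteq> 0"
    by linarith
  then show ?thesis
  proof cases
    case 1
    then show ?thesis using many_leaves_card_homs card_End_path_le[of "card V"] V3 by linarith
  next
    case 2
    then show ?thesis using three_leaves_card_homs[OF V3 2(1) z] card_End_path_le[of "card V"] V3 by linarith
  next
    case 3
    then have "E `` {z} \<inter> leaves \<noteq> {}" by (auto simp: leaf_deg_def)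
    then obtain l where "l \<in> leaves" "(z, l) \<in> E" by auto
    from spider_enumeration[OF V3 3(1) z this] obtain b c p where
      bc: "spider_walks b c" "b + c + 2 = card V" and p: "bij_betw p {..<b + c + 2} V"
        "E = (\<lambda>(i, j). (p i, p j)) ` spider b c" by blast
    have "card (End (path_graph (b + c + 2))) \<le> card (homs {..<b + c + 2} (spider b c) {..<b + c + 2} (spider b c))"
      using spider_walks.card_End_path_le_spider[OF bc(1)] by linarith
    also have "\<dots> \<le> card (homs V E V E)"
      by (rule card_homs_le_of_bij[OF p(1) _ p(2) finite_V]) (auto simp: spider_def)
    finally show ?thesis by (simp only: bc(2))
  qed
qed

theorem theorem1p8:
  fixes T :: "'a pair_pre_digraph" and n :: nat
  assumes "undirected_tree T" and "card (pverts T) = n"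
  shows "card (End (path_graph n)) \<le> card (End T) \<and>
         card (End T) \<le> card (End (star_graph n))"
proof -
  have "pverts T \<noteq> {}"
    using assms(1) by (auto simp: undirected_tree_def connected_def strongly_connected_def mk_symmetric_def)
  then obtain r where r: "r \<in> pverts T" by blast
  then interpret tree_graph "pverts T" "parcs T"
    using undirected_tree_imp_rooted_tree[OF assms(1)] by (intro rooted_tree_tree_graph)
  have "card (End T) \<le> card (End (star_graph n))"
  proof (cases "n \<ge> 2")
    case True
    then show ?thesis using card_homs_self_le card_End_star[OF True] assms(2) by (simp add: End_eq_homs)
  next
    case False
    moreover have "n > 0" using assms(2) r finite_V by (auto simp: card_gt_0_iff)
    ultimately have n1: "n = 1" by simp
    then obtain x where x: "pverts T = {x}" using assms(2) by (auto simp: card_1_singleton_iff)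
    have "End T \<subseteq> {x} \<rightarrow>\<^sub>E {x}" unfolding End_def x by auto
    then have "card (End T) \<le> card ({x} \<rightarrow>\<^sub>E {x})" by (intro card_mono finite_PiE) auto
    also have "\<dots> = 1" by (simp add: card_PiE)
    also have "1 \<le> card (End (star_graph n))"
    proof -
      have "(\<lambda>i\<in>{0}. 0) \<in> End (star_graph n)" using n1
        by (auto simp: End_def star_graph_def split: if_splits)
      then show ?thesis using pair_graph.finite_End[OF pair_graph_star_graph]
        by (metis One_nat_def Suc_leI card_gt_0_iff empty_iff)
    qed
    finally show ?thesis .
  qed
  moreover have "card (End (path_graph n)) \<le> card (End T)"
    using card_End_path_le_card_homs assms(2) by (simp add: End_eq_homs)
  ultimately show ?thesis by simp
qed

end
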